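(* Let $Y\subseteq\mathbb N$ be an $\omega$-c.e. set such that there is a diagonally noncomputable function $f$ with $f\le_{\mathrm{wtt}}Y$. Let $A$ be a strongly jump traceable c.e. set. Then $A\le_{ibT}Y$.
   Context: A set $Y$ is $\omega$-c.e. if it has a computable approximation $\langle Y_s\rangle$ (a computable sequence of finite sets with $\lim_sY_s(x)=Y(x)$) such that $\#\{s: Y_s(x)\ne Y_{s-1}(x)\}$ is bounded by a computable function of $x$. A function $f:\mathbb N\to\mathbb N$ is diagonally noncomputable (d.n.c.) if $f(e)\neq\varphi_e(e)$ whenever $\varphi_e(e)$ converges. $\le_{\mathrm{wtt}}$ is weak truth-table reducibility (Turing reducibility with computably bounded use). An order function is a computable, nondecreasing, unbounded function $h:\mathbb N\to\mathbb N\setminus\{0\}$. Writing $J^A(x)=\varphi^A_x(x)$ for the universal partial $A$-computable jump function, $A$ is strongly jump traceable if for each order function $h$ there is a uniformly c.e. sequence $\langle T_x\rangle_{x\in\mathbb N}$ of sets with $\#T_x\le h(x)$ for all $x$, such that $J^A(x)\in T_x$ whenever $J^A(x)$ is defined. $A\le_{ibT}Y$ means that $A$ is Turing reducible to $Y$ with use function bounded by the identity (on input $x$ each oracle query is at most $x$). *)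

theory Defs
  imports Main "HOL-Library.Nat_Bijection"
begin

text \<open>
  Kleene-style programs for the partial recursive functions relative to an oracle. All programs are
  unary; several arguments are passed as one number through the Cantor pairing
  \<^const>\<open>prod_encode\<close>, a bijection from pairs of numbers to numbers.
\<close>

datatype prog =
    Zero | Succ | Ident | First | Second | Oracle
  | Pairing prog prog
  | Compose prog prog
  | PrimRec prog prog
  | Minimize prog

text \<open>
  \<open>run A p x y Q\<close>: with oracle \<open>A\<close> and input \<open>x\<close>, the program \<open>p\<close> halts with output \<open>y\<close>, and \<open>Q\<close> is
  the set of oracle queries made during that computation.
  In the rule \<open>Minimize\<close>, \<open>z m\<close> and \<open>Q m\<close> are the predecessor of the value of \<open>p\<close> at \<open>(x, m)\<close> and the
  queries made while computing it.
\<close>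

inductive run :: "nat set \<Rightarrow> prog \<Rightarrow> nat \<Rightarrow> nat \<Rightarrow> nat set \<Rightarrow> bool" for A :: "nat set" where
  Zero: "run A Zero x 0 {}"
| Succ: "run A Succ x (Suc x) {}"
| Ident: "run A Ident x x {}"
| First: "run A First (prod_encode (a, b)) a {}"
| Second: "run A Second (prod_encode (a, b)) b {}"
| Oracle: "run A Oracle x (of_bool (x \<in> A)) {x}"
| Pairing: "run A p x a Q \<Longrightarrow> run A q x b R \<Longrightarrow> run A (Pairing p q) x (prod_encode (a, b)) (Q \<union> R)"
| Compose: "run A q x a Q \<Longrightarrow> run A p a b R \<Longrightarrow> run A (Compose p q) x b (Q \<union> R)"
| PrimRec_0: "run A p x y Q \<Longrightarrow> run A (PrimRec p q) (prod_encode (x, 0)) y Q"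
| PrimRec_Suc: "run A (PrimRec p q) (prod_encode (x, n)) a Q \<Longrightarrow>
    run A q (prod_encode (prod_encode (x, n), a)) y R \<Longrightarrow>
    run A (PrimRec p q) (prod_encode (x, Suc n)) y (Q \<union> R)"
| Minimize: "(\<And>m. m < n \<Longrightarrow> run A p (prod_encode (x, m)) (Suc (z m)) (Q m)) \<Longrightarrow>
    run A p (prod_encode (x, n)) 0 (Q n) \<Longrightarrow>
    run A (Minimize p) x n (\<Union>m\<le>n. Q m)"

lemma run_deterministic:
  "run A p x y Q \<Longrightarrow> run A p x y' Q' \<Longrightarrow> y = y' \<and> Q = Q'"
proof (induction arbitrary: y' Q' rule: run.induct)
  case (Zero x)
  then show ?case by cases auto
next
  case (Succ x)
  then show ?case by cases auto
next
  case (Ident x)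
  then show ?case by cases auto
next
  case (First a b)
  then show ?case by cases auto
next
  case (Second a b)
  then show ?case by cases auto
next
  case (Oracle x)
  then show ?case by cases auto
next
  case (Pairing p x a Q q b R)
  from Pairing.prems show ?case
    by cases (use Pairing.IH in blast)
next
  case (Compose q x a Q p b R)
  from Compose.prems show ?case
    by cases (use Compose.IH in blast)
next
  case (PrimRec_0 p x y Q q)
  from PrimRec_0.prems show ?case
    by cases (auto dest: PrimRec_0.IH)
next
  case (PrimRec_Suc p q x n a Q y R)
  from PrimRec_Suc.prems show ?case
    by cases (auto dest: PrimRec_Suc.IH)
next
  case (Minimize n p x z Q)
  from Minimize.prems obtain z' R where R:
    "\<And>m. m < y' \<Longrightarrow> run A p (prod_encode (x, m)) (Suc (z' m)) (R m)"
    "run A p (prod_encode (x, y')) 0 (R y')" "Q' = (\<Union>m\<le>y'. R m)"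
    by cases auto
  have "\<not> y' < n" using Minimize.IH(1) R(2) by blast
  moreover have "\<not> n < y'" using Minimize.IH(2) R(1) by blast
  ultimately have n: "n = y'" by simp
  have "Q m = R m" if "m \<le> n" for m
  proof (cases "m = n")
    case True then show ?thesis using Minimize.IH(2) R(2) n by blast
  next
    case False then have "m < n" using that by simp
    then show ?thesis using Minimize.IH(1) R(1) n by blast
  qed
  then show ?case using n R(3) by auto
qed

text \<open>An effective Goedel numbering; it is bijective, so every number is the index of one program.\<close>

primrec code :: "prog \<Rightarrow> nat" where
  "code Zero = 0"
| "code Succ = 1"
| "code Ident = 2"
| "code First = 3"
| "code Second = 4"
| "code Oracle = 5"
| "code (Pairing p q) = 6 + 4 * prod_encode (code p, code q)"
| "code (Compose p q) = 7 + 4 * prod_encode (code p, code q)"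
| "code (PrimRec p q) = 8 + 4 * prod_encode (code p, code q)"
| "code (Minimize p) = 9 + 4 * code p"

lemma bij_code: "bij code"
proof (rule bijI)
  show "inj code"
  proof (rule injI)
    have res: "(6 + 4 * a) mod 4 = 2" "(7 + 4 * a) mod 4 = 3" "(8 + 4 * a) mod 4 = 0"
      "(9 + 4 * a) mod 4 = 1" for a :: nat by presburger+
    have dist: "6 + 4 * a \<noteq> 7 + 4 * b" "6 + 4 * a \<noteq> 8 + 4 * b" "6 + 4 * a \<noteq> 9 + 4 * b"
      "7 + 4 * a \<noteq> 8 + 4 * b" "7 + 4 * a \<noteq> 9 + 4 * b" "8 + 4 * a \<noteq> 9 + 4 * b" for a b :: nat
      using res[of a] res[of b] by (metis zero_neq_numeral one_neq_zero numeral_eq_iff num.distinct numeral_eq_one_iff numeral_neq_zero)+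
    note dist = dist dist[symmetric]
    fix p q show "code p = code q \<Longrightarrow> p = q"
      by (induction p arbitrary: q; case_tac q; simp add: dist)
  qed
  have "\<exists>p. code p = n" for n
  proof (induction n rule: less_induct)
    case (less n)
    show ?case
    proof (cases "n < 6")
      case True
      then have "n \<in> {code Zero, code Succ, code Ident, code First, code Second, code Oracle}" by auto
      then show ?thesis by blast
    next
      case False
      define k where "k = (n - 6) div 4"
      obtain a b where ab: "k = prod_encode (a, b)"
        by (metis prod_decode_inverse surj_pair)
      have k: "k < n" using False unfolding k_def by simp
      then have "a < n" "b < n"
        using ab le_prod_encode_1[of a b] le_prod_encode_2[of b a] by linarith+
      with k less obtain p q r where "code p = a" "code q = b" "code r = k" by meson
      moreover have "n = 6 + 4 * k \<or> n = 7 + 4 * k \<or> n = 8 + 4 * k \<or> n = 9 + 4 * k"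
        using False unfolding k_def by presburger
      ultimately have "n \<in> {code (Pairing p q), code (Compose p q), code (PrimRec p q), code (Minimize r)}"
        using ab by auto
      then show ?thesis by blast
    qed
  qed
  then show "surj code" unfolding surj_def by metis
qed

text \<open>\<open>phi A e x y\<close> is \<open>\<phi>\<^sub>e\<^sup>A(x)\<down> = y\<close>; the unrelativised \<open>\<phi>\<^sub>e\<close> is obtained with the oracle \<open>{}\<close>.\<close>

definition phi :: "nat set \<Rightarrow> nat \<Rightarrow> nat \<Rightarrow> nat \<Rightarrow> bool" where
  "phi A e x y \<longleftrightarrow> (\<exists>p Q. code p = e \<and> run A p x y Q)"

definition jump_fun :: "nat set \<Rightarrow> nat \<Rightarrow> nat \<Rightarrow> bool" where
  "jump_fun A x y \<longleftrightarrow> phi A x x y"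

definition computable :: "(nat \<Rightarrow> nat) \<Rightarrow> bool" where
  "computable f \<longleftrightarrow> (\<exists>e. \<forall>x. phi {} e x (f x))"

definition ce :: "nat set \<Rightarrow> bool" where
  "ce A \<longleftrightarrow> (\<exists>e. A = {x. \<exists>y. phi {} e x y})"

definition uniformly_ce :: "(nat \<Rightarrow> nat set) \<Rightarrow> bool" where
  "uniformly_ce T \<longleftrightarrow> ce {prod_encode (x, y) | x y. y \<in> T x}"

text \<open>
  A computable sequence of finite sets is given by strong (canonical) indices;
  \<^const>\<open>set_encode\<close> maps a finite set \<open>F\<close> to the sum of \<open>2 ^ i\<close> over \<open>i \<in> F\<close>.
\<close>

definition computable_approx :: "(nat \<Rightarrow> nat set) \<Rightarrow> nat set \<Rightarrow> bool" where
  "computable_approx Ys Y \<longleftrightarrow>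
     (\<forall>s. finite (Ys s)) \<and> computable (\<lambda>s. set_encode (Ys s)) \<and>
     (\<forall>x. \<exists>t. \<forall>s\<ge>t. x \<in> Ys s \<longleftrightarrow> x \<in> Y)"

definition omega_ce :: "nat set \<Rightarrow> bool" where
  "omega_ce Y \<longleftrightarrow>
     (\<exists>Ys b. computable_approx Ys Y \<and> computable b \<and>
        (\<forall>x. finite {s. s > 0 \<and> (x \<in> Ys s) \<noteq> (x \<in> Ys (s - 1))} \<and>
             card {s. s > 0 \<and> (x \<in> Ys s) \<noteq> (x \<in> Ys (s - 1))} \<le> b x))"

definition dnc :: "(nat \<Rightarrow> nat) \<Rightarrow> bool" where
  "dnc f \<longleftrightarrow> (\<forall>e y. phi {} e e y \<longrightarrow> f e \<noteq> y)"

text \<open>\<open>f\<close> is Turing reducible to \<open>Y\<close> by a reduction all of whose queries on input \<open>x\<close> are at most \<open>u x\<close>.\<close>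

definition reducible_with_use :: "(nat \<Rightarrow> nat) \<Rightarrow> nat set \<Rightarrow> (nat \<Rightarrow> nat) \<Rightarrow> bool" where
  "reducible_with_use f Y u \<longleftrightarrow> (\<exists>p. \<forall>x. \<exists>Q. run Y p x (f x) Q \<and> (\<forall>q\<in>Q. q \<le> u x))"

definition wtt_reducible :: "(nat \<Rightarrow> nat) \<Rightarrow> nat set \<Rightarrow> bool" where
  "wtt_reducible f Y \<longleftrightarrow> (\<exists>u. computable u \<and> reducible_with_use f Y u)"

definition ibT_reducible :: "nat set \<Rightarrow> nat set \<Rightarrow> bool" where
  "ibT_reducible A Y \<longleftrightarrow> reducible_with_use (\<lambda>x. of_bool (x \<in> A)) Y (\<lambda>x. x)"

definition order_function :: "(nat \<Rightarrow> nat) \<Rightarrow> bool" where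
  "order_function h \<longleftrightarrow> computable h \<and> mono h \<and> (\<forall>n. \<exists>x. n \<le> h x) \<and> (\<forall>x. h x > 0)"

definition strongly_jump_traceable :: "nat set \<Rightarrow> bool" where
  "strongly_jump_traceable A \<longleftrightarrow>
     (\<forall>h. order_function h \<longrightarrow>
        (\<exists>T. uniformly_ce T \<and> (\<forall>x. finite (T x) \<and> card (T x) \<le> h x) \<and>
             (\<forall>x y. jump_fun A x y \<longrightarrow> y \<in> T x)))"

end

(*
  On input x the reduction searches for a late stage at which Y looks correct up to x, and answers
  according to the approximation of A at that stage. It can only err if x enters A later. Attach
  to each level n a bound V n on the use of f at finitely many indices g under our control, and
  take the largest n such that Y has been stable below V n since about stage x. When x enters A,
  one defines phi_g(g) as the value of f(g) computed from the current Y. If the answer about x was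
  wrong, this Y is correct below V n, so f(g) = phi_g(g), contradicting d.n.c.

  Each such event uses up one index of level n, so their number must be bounded before V n is known.
  Y changes at most C (n + 1) times below V (n + 1), and after each such change the initial segment
  of A that is no longer protected is tested: it is made the value of the jump at certain boxes, and
  the construction waits for it to appear in the trace. If A changes below a tested length, every
  box used by the test has lost one of its at most n + 2 possible values, and later tests of this
  level are run on these promoted boxes only. So level n + 1 fails at most n + 1 times, whatever
  C (n + 1) is. The boxes of level n are the numbers m < C n ^ (n + 2), read in base C n: after k
  failures, in epochs i_0, ..., i_(k-1), the test in epoch i uses the m with first digits
  i_0, ..., i_(k-1), i.
*)
theory Submission
  imports Defs
begin

subsection \<open>Total functions computed without oracle queries\<close>

abbreviation pfst :: "nat \<Rightarrow> nat" where "pfst z \<equiv> fst (prod_decode z)"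
abbreviation psnd :: "nat \<Rightarrow> nat" where "psnd z \<equiv> snd (prod_decode z)"
abbreviation pair :: "nat \<Rightarrow> nat \<Rightarrow> nat" where "pair a b \<equiv> prod_encode (a, b)"

lemma pair_surj: "pair (pfst z) (psnd z) = z"
  by simp

text \<open>One program has to serve all oracles without queries. Such functions can then be used
  inside the box programs, which run with oracle \<open>A\<close>, and inside the reduction, where
  they add nothing to the use of \<open>Y\<close>.\<close>

definition cmp :: "(nat \<Rightarrow> nat) \<Rightarrow> bool" where
  "cmp f \<longleftrightarrow> (\<exists>p. \<forall>A x. run A p x (f x) {})"

abbreviation dec :: "(nat \<Rightarrow> bool) \<Rightarrow> bool" where
  "dec P \<equiv> cmp (\<lambda>x. of_bool (P x))"

lemma cmpI: "(\<And>A x. run A p x (f x) {}) \<Longrightarrow> cmp f"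
  unfolding cmp_def by blast

lemma cmpE: assumes "cmp f" obtains p where "\<And>A x. run A p x (f x) {}"
  using assms unfolding cmp_def by blast

lemma run_Compose: "run A q x a {} \<Longrightarrow> run A p a b R \<Longrightarrow> run A (Compose p q) x b R"
  using run.Compose[of A q x a "{}" p b R] by simp

lemma run_Pairing: "run A p x a {} \<Longrightarrow> run A q x b R \<Longrightarrow> run A (Pairing p q) x (pair a b) R"
  using run.Pairing[of A p x a "{}" q b R] by simp

lemma cmp_id: "cmp (\<lambda>x. x)"
  by (rule cmpI[of Ident]) (rule run.Ident)

lemma cmp_comp: "cmp f \<Longrightarrow> cmp g \<Longrightarrow> cmp (\<lambda>x. f (g x))"
  by (elim cmpE, rule cmpI, rule run_Compose) 

lemma cmp_pair: "cmp f \<Longrightarrow> cmp g \<Longrightarrow> cmp (\<lambda>x. pair (f x) (g x))"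
  by (elim cmpE, rule cmpI, rule run_Pairing)

lemma cmp_pfst0: "cmp pfst"
  by (rule cmpI[of First]) (metis pair_surj run.First)

lemma cmp_psnd0: "cmp psnd"
  by (rule cmpI[of Second]) (metis pair_surj run.Second)

lemma cmp_Suc0: "cmp Suc"
  by (rule cmpI[of Succ]) (rule run.Succ)

lemmas cmp_pfst = cmp_comp[OF cmp_pfst0]
lemmas cmp_psnd = cmp_comp[OF cmp_psnd0]
lemmas cmp_Suc = cmp_comp[OF cmp_Suc0]

primrec Const :: "nat \<Rightarrow> prog" where
  "Const 0 = Zero"
| "Const (Suc c) = Compose Succ (Const c)"

lemma run_Const: "run A (Const c) x c {}"
  by (induction c) (auto intro: run.Zero run.Succ run_Compose)

lemma cmp_const: "cmp (\<lambda>x. c)"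
  by (rule cmpI) (rule run_Const)

lemma cmp_comp2:
  "cmp (\<lambda>z. F (pfst z) (psnd z)) \<Longrightarrow> cmp f \<Longrightarrow> cmp g \<Longrightarrow> cmp (\<lambda>x. F (f x) (g x))"
  using cmp_comp[OF _ cmp_pair, of "\<lambda>z. F (pfst z) (psnd z)" f g] by simp

lemma cmp_comp3:
  "cmp (\<lambda>z. F (pfst (pfst z)) (psnd (pfst z)) (psnd z)) \<Longrightarrow> cmp f \<Longrightarrow> cmp g \<Longrightarrow> cmp h \<Longrightarrow>
    cmp (\<lambda>x. F (f x) (g x) (h x))"
  using cmp_comp[OF _ cmp_pair[OF cmp_pair], of "\<lambda>z. F (pfst (pfst z)) (psnd (pfst z)) (psnd z)" f g h]
  by simp

lemma cmp_rec:
  assumes "cmp f" "cmp (\<lambda>z. g (pfst (pfst z)) (psnd (pfst z)) (psnd z))" "cmp n"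
  shows "cmp (\<lambda>x. rec_nat (f x) (g x) (n x))"
proof -
  obtain p where p: "\<And>A x. run A p x (f x) {}" using assms(1) by (rule cmpE) auto
  obtain q where q: "\<And>A z. run A q z (g (pfst (pfst z)) (psnd (pfst z)) (psnd z)) {}"
    using assms(2) by (rule cmpE) auto
  obtain r where r: "\<And>A x. run A r x (n x) {}" using assms(3) by (rule cmpE) auto
  have "run A (PrimRec p q) (pair x m) (rec_nat (f x) (g x) m) {}" for A x m
  proof (induction m)
    case 0
    show ?case by (simp add: run.PrimRec_0 p)
  next
    case (Suc m)
    from run.PrimRec_Suc[OF this q] show ?case by simp
  qed
  then have "run A (Compose (PrimRec p q) (Pairing Ident r)) x (rec_nat (f x) (g x) (n x)) {}" for A x
    by (rule run_Compose[rotated]) (intro run_Pairing run.Ident r)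
  then show ?thesis by (rule cmpI)
qed

named_theorems cmp_intros

lemmas [cmp_intros] = cmp_id cmp_const cmp_pair cmp_pfst cmp_psnd cmp_Suc

lemma cmp_add [cmp_intros]: "cmp f \<Longrightarrow> cmp g \<Longrightarrow> cmp (\<lambda>x. f x + g x)"
proof -
  assume fg: "cmp f" "cmp g"
  have "rec_nat (f x) (\<lambda>k r. Suc r) m = f x + m" for x m by (induction m) auto
  with cmp_rec[OF fg(1) _ fg(2), of "\<lambda>x k r. Suc r"] show ?thesis
    by (simp add: cmp_intros)
qed

lemma cmp_pred: "cmp f \<Longrightarrow> cmp (\<lambda>x. f x - 1)"
proof -
  assume f: "cmp f"
  have "rec_nat 0 (\<lambda>k r. k) m = m - 1" for m :: nat by (cases m) auto
  with cmp_rec[OF cmp_const[of 0] _ f, of "\<lambda>x k r. k"] show ?thesis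
    by (simp add: cmp_intros)
qed

lemma cmp_diff [cmp_intros]: "cmp f \<Longrightarrow> cmp g \<Longrightarrow> cmp (\<lambda>x. f x - g x)"
proof -
  assume fg: "cmp f" "cmp g"
  have "rec_nat (f x) (\<lambda>k r. r - 1) m = f x - m" for x m by (induction m) auto
  moreover have "cmp (\<lambda>x. rec_nat (f x) (\<lambda>k r. r - 1) (g x))"
    by (intro cmp_rec fg cmp_pred cmp_intros)
  ultimately show ?thesis by simp
qed

lemma cmp_mult [cmp_intros]: "cmp f \<Longrightarrow> cmp g \<Longrightarrow> cmp (\<lambda>x. f x * g x)"
proof -
  assume fg: "cmp f" "cmp g"
  have "rec_nat 0 (\<lambda>k r. r + f x) m = f x * m" for x m by (induction m) auto
  moreover have "cmp (\<lambda>x. rec_nat 0 (\<lambda>k r. r + f x) (g x))"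
    by (intro cmp_rec cmp_intros fg cmp_comp[OF fg(1)])
  ultimately show ?thesis by simp
qed

lemma cmp_power [cmp_intros]: "cmp f \<Longrightarrow> cmp g \<Longrightarrow> cmp (\<lambda>x. f x ^ g x)"
proof -
  assume fg: "cmp f" "cmp g"
  have "rec_nat 1 (\<lambda>k r. r * f x) m = f x ^ m" for x m by (induction m) auto
  moreover have "cmp (\<lambda>x. rec_nat 1 (\<lambda>k r. r * f x) (g x))"
    by (intro cmp_rec cmp_intros fg cmp_comp[OF fg(1)])
  ultimately show ?thesis by simp
qed

lemma cmp_sum [cmp_intros]:
  "cmp (\<lambda>z. f (pfst z) (psnd z)) \<Longrightarrow> cmp n \<Longrightarrow> cmp (\<lambda>x. \<Sum>k<n x. f x k)"
proof -
  assume fn: "cmp (\<lambda>z. f (pfst z) (psnd z))" "cmp n"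
  have "rec_nat 0 (\<lambda>k r. r + f x k) m = (\<Sum>k<m. f x k)" for x m by (induction m) auto
  moreover have "cmp (\<lambda>x. rec_nat 0 (\<lambda>k r. r + f x k) (n x))"
    by (intro cmp_rec cmp_intros fn cmp_comp2[OF fn(1)])
  ultimately show ?thesis by simp
qed

lemma dec_le [cmp_intros]: "cmp f \<Longrightarrow> cmp g \<Longrightarrow> dec (\<lambda>x. f x \<le> g x)"
proof -
  assume "cmp f" "cmp g"
  then have "cmp (\<lambda>x. 1 - (f x - g x))" by (intro cmp_intros)
  moreover have "1 - (f x - g x) = of_bool (f x \<le> g x)" for x by simp
  ultimately show ?thesis by simp
qed

lemma dec_not [cmp_intros]: "dec P \<Longrightarrow> dec (\<lambda>x. \<not> P x)"
proof -
  assume "dec P"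
  then have "cmp (\<lambda>x. 1 - of_bool (P x))" by (intro cmp_intros)
  moreover have "1 - of_bool (P x) = (of_bool (\<not> P x) :: nat)" for x by simp
  ultimately show ?thesis by simp
qed

lemma dec_conj [cmp_intros]: "dec P \<Longrightarrow> dec Q \<Longrightarrow> dec (\<lambda>x. P x \<and> Q x)"
  unfolding of_bool_conj by (rule cmp_mult)

lemma dec_imp [cmp_intros]: "dec P \<Longrightarrow> dec Q \<Longrightarrow> dec (\<lambda>x. P x \<longrightarrow> Q x)"
proof -
  assume "dec P" "dec Q"
  then have "dec (\<lambda>x. \<not> (P x \<and> \<not> Q x))" by (intro cmp_intros)
  then show ?thesis by simp
qed

lemma dec_iff [cmp_intros]: "dec P \<Longrightarrow> dec Q \<Longrightarrow> dec (\<lambda>x. P x = Q x)"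
proof -
  assume "dec P" "dec Q"
  then have "dec (\<lambda>x. (P x \<longrightarrow> Q x) \<and> (Q x \<longrightarrow> P x))" by (intro cmp_intros)
  moreover have "((P x \<longrightarrow> Q x) \<and> (Q x \<longrightarrow> P x)) = (P x = Q x)" for x by blast
  ultimately show ?thesis by simp
qed

lemma dec_less [cmp_intros]: "cmp f \<Longrightarrow> cmp g \<Longrightarrow> dec (\<lambda>x. f x < g x)"
  unfolding less_eq_Suc_le by (intro cmp_intros)

lemma dec_eq [cmp_intros]: "cmp f \<Longrightarrow> cmp g \<Longrightarrow> dec (\<lambda>x. f x = g x)"
  unfolding eq_iff by (intro cmp_intros)

lemma cmp_If [cmp_intros]:
  "dec P \<Longrightarrow> cmp f \<Longrightarrow> cmp g \<Longrightarrow> cmp (\<lambda>x. if P x then f x else g x)"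
proof -
  assume "dec P" "cmp f" "cmp g"
  then have "cmp (\<lambda>x. of_bool (P x) * f x + (1 - of_bool (P x)) * g x)" by (intro cmp_intros)
  moreover have "of_bool (P x) * f x + (1 - of_bool (P x)) * g x = (if P x then f x else g x)" for x
    by simp
  ultimately show ?thesis by simp
qed

lemma cmp_max [cmp_intros]: "cmp f \<Longrightarrow> cmp g \<Longrightarrow> cmp (\<lambda>x. max (f x) (g x))"
  unfolding max_def by (intro cmp_intros)

lemma dec_all_less [cmp_intros]:
  "dec (\<lambda>z. P (pfst z) (psnd z)) \<Longrightarrow> cmp n \<Longrightarrow> dec (\<lambda>x. \<forall>k<n x. P x k)"
proof -
  assume "dec (\<lambda>z. P (pfst z) (psnd z))" "cmp n"
  then have "dec (\<lambda>x. (\<Sum>k<n x. of_bool (\<not> P x k)) = (0::nat))" by (intro cmp_intros)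
  moreover have "((\<Sum>k<n x. of_bool (\<not> P x k)) = (0::nat)) = (\<forall>k<n x. P x k)" for x by auto
  ultimately show ?thesis by simp
qed

lemma dec_all_le [cmp_intros]:
  "dec (\<lambda>z. P (pfst z) (psnd z)) \<Longrightarrow> cmp n \<Longrightarrow> dec (\<lambda>x. \<forall>k\<le>n x. P x k)"
  unfolding less_Suc_eq_le[symmetric] by (intro cmp_intros)

lemma cmp_div [cmp_intros]: "cmp f \<Longrightarrow> cmp g \<Longrightarrow> cmp (\<lambda>x. f x div g x)"
proof -
  assume fg: "cmp f" "cmp g"
  \<comment> \<open>The quotient counts the positive multiples of \<open>b\<close> up to
    \<open>a\<close>; the guard \<open>0 < b\<close> yields 0 for division by 0.\<close>
  have "(\<Sum>k<a. of_bool (0 < b \<and> Suc k * b \<le> a)) = a div b" for a b :: nat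
  proof (cases "b = 0")
    case False
    have "(\<Sum>k<a. of_bool (0 < b \<and> Suc k * b \<le> a)) = card {k. k < a \<and> Suc k \<le> a div b}"
      using False by (simp add: less_eq_div_iff_mult_less_eq Int_def del: mult_Suc)
    also have "{k. k < a \<and> Suc k \<le> a div b} = {..<a div b}"
      using div_le_dividend[of a b] by (auto simp del: div_le_dividend)
    finally show ?thesis by simp
  qed simp
  moreover have "cmp (\<lambda>x. \<Sum>k<f x. of_bool (0 < g x \<and> Suc k * g x \<le> f x))"
    by (intro cmp_intros fg cmp_comp[OF fg(1)] cmp_comp[OF fg(2)])
  ultimately show ?thesis by simp
qed

lemma cmp_mod [cmp_intros]: "cmp f \<Longrightarrow> cmp g \<Longrightarrow> cmp (\<lambda>x. f x mod g x)"
  unfolding modulo_nat_def by (intro cmp_intros)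

lemma dec_set_decode [cmp_intros]: "cmp f \<Longrightarrow> cmp g \<Longrightarrow> dec (\<lambda>x. f x \<in> set_decode (g x))"
proof -
  assume "cmp f" "cmp g"
  then have "dec (\<lambda>x. (g x div 2 ^ f x) mod 2 = 1)" by (intro cmp_intros)
  then show ?thesis by (simp add: set_decode_def odd_iff_mod_2_eq_one)
qed

section \<open>Unbounded search and elimination of oracle queries\<close>

lemma run_Minimize:
  assumes "\<And>A z. run A p z (F z) {}" "F (pair x k) = 0"
  shows "run A (Minimize p) x (LEAST m. F (pair x m) = 0) {}"
proof -
  let ?n = "LEAST m. F (pair x m) = 0"
  have "run A p (pair x m) (Suc (F (pair x m) - 1)) {}" if "m < ?n" for m
    using not_less_Least[OF that] assms(1)[of A "pair x m"] by simp
  moreover have "run A p (pair x ?n) 0 {}"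
    using LeastI[of "\<lambda>m. F (pair x m) = 0", OF assms(2)] assms(1)[of A "pair x ?n"] by simp
  ultimately have "run A (Minimize p) x ?n (\<Union>m\<le>?n. {})"
    by (rule run.Minimize)
  then show ?thesis by simp
qed

lemma partial_Least:
  assumes "dec (\<lambda>z. P (pfst z) (psnd z))"
  obtains p where "\<And>A x k. P x k \<Longrightarrow> run A p x (LEAST m. P x m) {}"
proof -
  have "cmp (\<lambda>z. of_bool (\<not> P (pfst z) (psnd z)))" using assms by (intro cmp_intros)
  then obtain p where p: "\<And>A z. run A p z (of_bool (\<not> P (pfst z) (psnd z))) {}"
    by (rule cmpE) auto
  have "run A (Minimize p) x (LEAST m. P x m) {}" if "P x k" for A x k
    using run_Minimize[OF p, of x k A] that by simp
  then show thesis by (rule that)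
qed

lemma cmp_Least [cmp_intros]:
  assumes "dec (\<lambda>z. P (pfst z) (psnd z))" "\<And>x. \<exists>k. P x k"
  shows "cmp (\<lambda>x. LEAST k. P x k)"
  using assms(2) by (rule_tac partial_Least[OF assms(1)]) (metis cmpI)

text \<open>A program run with the empty oracle may still ask queries, but every answer is 0, so
  \<open>Zero\<close> can replace \<open>Oracle\<close>. Hence \<open>computable\<close> and
  \<open>cmp\<close> coincide.\<close>

primrec query_free :: "prog \<Rightarrow> prog" where
  "query_free Zero = Zero"
| "query_free Succ = Succ"
| "query_free Ident = Ident"
| "query_free First = First"
| "query_free Second = Second"
| "query_free Oracle = Zero"
| "query_free (Pairing p q) = Pairing (query_free p) (query_free q)"
| "query_free (Compose p q) = Compose (query_free p) (query_free q)"
| "query_free (PrimRec p q) = PrimRec (query_free p) (query_free q)"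
| "query_free (Minimize p) = Minimize (query_free p)"

lemma run_query_free: "run {} p x y Q \<Longrightarrow> run A (query_free p) x y {}"
proof (induction rule: run.induct)
  case (PrimRec_Suc p q x n a Q y R)
  then show ?case
    using run.PrimRec_Suc[of A "query_free p" "query_free q" x n a "{}" y "{}"] by simp
next
  case (Minimize n p x z Q)
  then show ?case using run.Minimize[of n A "query_free p" x z "\<lambda>_. {}"] by simp
qed (auto intro: run.intros run_Compose run_Pairing)

lemma computable_iff_cmp: "computable f \<longleftrightarrow> cmp f"
proof
  assume "computable f"
  then obtain e where "\<And>x. \<exists>p Q. code p = e \<and> run {} p x (f x) Q"
    unfolding computable_def phi_def by blast
  moreover obtain p where "code p = e" using bij_code by (metis bij_pointE)
  ultimately have "\<exists>Q. run {} p x (f x) Q" for x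
    by (metis bij_code bij_is_inj injD)
  then show "cmp f" by (meson cmpI run_query_free)
next
  assume "cmp f"
  then show "computable f" unfolding computable_def phi_def by (metis cmpE)
qed

subsection \<open>Step-bounded evaluation\<close>

text \<open>\<open>ev p d x s\<close> is \<open>0\<close> if no result is known after \<open>s\<close> steps, and \<open>Suc y\<close> if the result is \<open>y\<close>.\<close>

primrec ev :: "prog \<Rightarrow> nat \<Rightarrow> nat \<Rightarrow> nat \<Rightarrow> nat" where
  "ev Zero d x s = 1"
| "ev Succ d x s = Suc (Suc x)"
| "ev Ident d x s = Suc x"
| "ev First d x s = Suc (pfst x)"
| "ev Second d x s = Suc (psnd x)"
| "ev Oracle d x s = Suc (of_bool (x \<in> set_decode d))"
| "ev (Pairing p q) d x s = (if ev p d x s = 0 then 0 else if ev q d x s = 0 then 0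
     else Suc (pair (ev p d x s - 1) (ev q d x s - 1)))"
| "ev (Compose p q) d x s = (if ev q d x s = 0 then 0 else ev p d (ev q d x s - 1) s)"
| "ev (PrimRec p q) d x s = rec_nat (ev p d (pfst x) s)
     (\<lambda>k r. if r = 0 then 0 else ev q d (pair (pair (pfst x) k) (r - 1)) s) (psnd x)"
| "ev (Minimize p) d x s = (\<Sum>n<s. if ev p d (pair x n) s = 1 \<and> (\<forall>m<n. 1 < ev p d (pair x m) s)
     then Suc n else 0)"

lemma cmp_ev0: "cmp (\<lambda>z. ev p (pfst (pfst z)) (psnd (pfst z)) (psnd z))"
proof (induction p)
  case (Compose p q)
  note ih = cmp_comp3[OF Compose.IH(1)] cmp_comp3[OF Compose.IH(2)]
  show ?case unfolding ev.simps by (intro cmp_intros ih)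
next
  case (Pairing p q)
  note ih = cmp_comp3[OF Pairing.IH(1)] cmp_comp3[OF Pairing.IH(2)]
  show ?case unfolding ev.simps by (intro cmp_intros ih)
next
  case (PrimRec p q)
  note ih = cmp_comp3[OF PrimRec.IH(1)] cmp_comp3[OF PrimRec.IH(2)]
  show ?case unfolding ev.simps by (intro cmp_rec cmp_intros ih)
next
  case (Minimize p)
  note ih = cmp_comp3[OF Minimize.IH]
  show ?case unfolding ev.simps by (intro cmp_intros ih)
qed (simp_all, (intro cmp_intros)+)

lemmas cmp_ev [cmp_intros] = cmp_comp3[OF cmp_ev0]

text \<open>The sum defining \<open>ev\<close> has at most one nonzero term: the value 1 at
  \<open>n\<close> excludes a value above 1 there, as a later candidate would require.\<close>

lemma ev_Minimize_Suc: "ev (Minimize p) d x s = Suc y \<longleftrightarrow>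
    y < s \<and> ev p d (pair x y) s = 1 \<and> (\<forall>m<y. 1 < ev p d (pair x m) s)"
    (is "_ \<longleftrightarrow> y < s \<and> ?P y")
proof -
  have uniq: "m = n" if "?P m" "?P n" for m n
  proof (rule ccontr)
    assume "m \<noteq> n"
    then consider "m < n" | "n < m" by linarith
    then show False using that by cases (metis less_irrefl)+
  qed
  have val: "ev (Minimize p) d x s = Suc n" if "n < s" "?P n" for n
  proof -
    have "ev (Minimize p) d x s = (\<Sum>m<s. if m = n then Suc n else 0)"
      unfolding ev.simps by (rule sum.cong) (use that uniq in auto)
    then show ?thesis using that by simp
  qed
  show ?thesis
  proof
    assume e: "ev (Minimize p) d x s = Suc y"
    have "\<exists>n<s. ?P n"
    proof (rule ccontr)
      assume "\<not> ?thesis"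
      then have "ev (Minimize p) d x s = 0" unfolding ev.simps by (intro sum.neutral) auto
      with e show False by simp
    qed
    with e val show "y < s \<and> ?P y" by (metis nat.inject)
  qed (use val in blast)
qed

lemma ev_mono: "ev p d x s = Suc y \<Longrightarrow> s \<le> s' \<Longrightarrow> ev p d x s' = Suc y"
proof (induction p arbitrary: x y)
  case (Pairing p q)
  from Pairing.prems obtain a b where "ev p d x s = Suc a" "ev q d x s = Suc b"
    by (cases "ev p d x s"; cases "ev q d x s") auto
  then show ?case using Pairing by simp
next
  case (Compose p q)
  from Compose.prems obtain a where "ev q d x s = Suc a"
    by (cases "ev q d x s") auto
  then show ?case using Compose by simp
next
  case (PrimRec p q)
  define R where "R s n = rec_nat (ev p d (pfst x) s)
     (\<lambda>k r. if r = 0 then 0 else ev q d (pair (pair (pfst x) k) (r - 1)) s) n" for s n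
  have "R s n = Suc y \<Longrightarrow> R s' n = Suc y" for n y
  proof (induction n arbitrary: y)
    case 0
    then show ?case using PrimRec unfolding R_def by simp
  next
    case (Suc n)
    moreover have "R s (Suc n) = (if R s n = 0 then 0
        else ev q d (pair (pair (pfst x) n) (R s n - 1)) s)" unfolding R_def by simp
    ultimately obtain a where a: "R s n = Suc a" by (cases "R s n") auto
    from Suc.IH[OF a] a Suc.prems PrimRec.IH(2) PrimRec.prems(2) show ?case unfolding R_def by simp
  qed
  then show ?case using PrimRec.prems unfolding R_def by simp
next
  case (Minimize p)
  from Minimize.prems have y: "y < s" "ev p d (pair x y) s = Suc 0"
    "\<forall>m<y. 1 < ev p d (pair x m) s" unfolding ev_Minimize_Suc by auto
  have "1 < ev p d (pair x m) s'" if "m < y" for m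
  proof -
    from y that obtain k where "ev p d (pair x m) s = Suc (Suc k)"
      by (metis One_nat_def less_imp_Suc_add plus_1_eq_Suc)
    with Minimize show ?thesis by (metis One_nat_def Suc_less_eq zero_less_Suc)
  qed
  with y Minimize show ?case unfolding ev_Minimize_Suc by auto
qed auto

lemma ev_sound: "ev p d x s = Suc y \<Longrightarrow> \<exists>Q. run (set_decode d) p x y Q"
proof (induction p arbitrary: x y)
  case First
  then show ?case by simp (metis pair_surj run.First)
next
  case Second
  then show ?case by simp (metis pair_surj run.Second)
next
  case (Pairing p q)
  from Pairing.prems obtain a b where "ev p d x s = Suc a" "ev q d x s = Suc b" "y = pair a b"
    by (cases "ev p d x s"; cases "ev q d x s") auto
  then show ?case using Pairing.IH run.Pairing by metis
next
  case (Compose p q)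
  from Compose.prems obtain a where "ev q d x s = Suc a" "ev p d a s = Suc y"
    by (cases "ev q d x s") auto
  then show ?case using Compose.IH run.Compose by metis
next
  case (PrimRec p q)
  define R where "R n = rec_nat (ev p d (pfst x) s)
     (\<lambda>k r. if r = 0 then 0 else ev q d (pair (pair (pfst x) k) (r - 1)) s) n" for n
  have "R n = Suc y \<Longrightarrow> \<exists>Q. run (set_decode d) (PrimRec p q) (pair (pfst x) n) y Q" for n y
  proof (induction n arbitrary: y)
    case 0
    then show ?case using PrimRec.IH(1) run.PrimRec_0 unfolding R_def by fastforce
  next
    case (Suc n)
    moreover have "R (Suc n) = (if R n = 0 then 0
        else ev q d (pair (pair (pfst x) n) (R n - 1)) s)" unfolding R_def by simp
    ultimately obtain a where a: "R n = Suc a" by (cases "R n") auto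
    with Suc.prems have "ev q d (pair (pair (pfst x) n) a) s = Suc y" unfolding R_def by simp
    with PrimRec.IH(2) Suc.IH[OF a] run.PrimRec_Suc show ?case by metis
  qed
  moreover have "R (psnd x) = Suc y" using PrimRec.prems unfolding R_def ev.simps .
  ultimately have "\<exists>Q. run (set_decode d) (PrimRec p q) (pair (pfst x) (psnd x)) y Q" .
  then show ?case by simp
next
  case (Minimize p)
  from Minimize.prems have y: "ev p d (pair x y) s = Suc 0"
    "\<forall>m<y. 1 < ev p d (pair x m) s" unfolding ev_Minimize_Suc by auto
  have "\<exists>k Q. run (set_decode d) p (pair x m) (Suc k) Q" if "m < y" for m
  proof -
    from y that obtain k where "ev p d (pair x m) s = Suc (Suc k)"
      by (metis One_nat_def less_imp_Suc_add plus_1_eq_Suc)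
    with Minimize.IH show ?thesis by blast
  qed
  then obtain k Q where kQ: "\<And>m. m < y \<Longrightarrow> run (set_decode d) p (pair x m) (Suc (k m)) (Q m)"
    by metis
  obtain R where "run (set_decode d) p (pair x y) 0 R" using Minimize.IH y by blast
  with kQ run.Minimize[of y "set_decode d" p x k "Q(y := R)"] show ?case by auto
next
  case Oracle
  then show ?case using run.Oracle[of "set_decode d" x] by auto
qed (auto intro: run.Zero run.Succ run.Ident)

lemma ev_complete: "run A p x y Q \<Longrightarrow> A = set_decode d \<Longrightarrow> \<exists>s. ev p d x s = Suc y"
proof (induction rule: run.induct)
  case (Pairing p x a Q q b R)
  then obtain s s' where "ev p d x s = Suc a" "ev q d x s' = Suc b" by blast
  then have "ev p d x (max s s') = Suc a" "ev q d x (max s s') = Suc b"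
    by (metis ev_mono max.cobounded1, metis ev_mono max.cobounded2)
  then have "ev (Pairing p q) d x (max s s') = Suc (pair a b)" by simp
  then show ?case ..
next
  case (Compose q x a Q p b R)
  then obtain s s' where "ev q d x s = Suc a" "ev p d a s' = Suc b" by blast
  then have "ev q d x (max s s') = Suc a" "ev p d a (max s s') = Suc b"
    by (metis ev_mono max.cobounded1, metis ev_mono max.cobounded2)
  then have "ev (Compose p q) d x (max s s') = Suc b" by simp
  then show ?case ..
next
  case (PrimRec_Suc p q x n a Q y R)
  then obtain s s' where "ev (PrimRec p q) d (pair x n) s = Suc a"
    "ev q d (pair (pair x n) a) s' = Suc y" by blast
  then have "ev (PrimRec p q) d (pair x n) (max s s') = Suc a"
    "ev q d (pair (pair x n) a) (max s s') = Suc y"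
    by (metis ev_mono max.cobounded1, metis ev_mono max.cobounded2)
  then have "ev (PrimRec p q) d (pair x (Suc n)) (max s s') = Suc y" by (simp cong: if_cong)
  then show ?case ..
next
  case (Minimize n p x z Q)
  then obtain s where s: "\<And>m. m < n \<Longrightarrow> ev p d (pair x m) (s m) = Suc (Suc (z m))" by metis
  from Minimize obtain s' where s': "ev p d (pair x n) s' = Suc 0" by blast
  \<comment> \<open>The stage exceeds the finitely many halting times, and also \<open>n\<close>,
    because the bounded search inspects only numbers below the stage.\<close>
  define t where "t = Suc n + s' + (\<Sum>m<n. s m)"
  have "s m \<le> t" if "m < n" for m
    unfolding t_def using member_le_sum[of m "{..<n}" s] that by simp
  then have "ev p d (pair x m) t = Suc (Suc (z m))" if "m < n" for m
    using s ev_mono that by blast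
  moreover have "ev p d (pair x n) t = Suc 0" using ev_mono[OF s'] unfolding t_def by simp
  ultimately have "ev (Minimize p) d x t = Suc n" unfolding ev_Minimize_Suc by (auto simp: t_def)
  then show ?case ..
qed auto

section \<open>The use principle, enumerations, and searches with an oracle\<close>

lemma run_use:
  "run A p x y Q \<Longrightarrow> (\<And>q. q \<in> Q \<Longrightarrow> q \<in> A \<longleftrightarrow> q \<in> B) \<Longrightarrow> run B p x y Q"
proof (induction rule: run.induct)
  case (Oracle x)
  then show ?case using run.Oracle[of B x] by simp
next
  case (Minimize n p x z Q)
  have "run B p (pair x m) (Suc (z m)) (Q m)" if "m < n" for m
    by (rule Minimize.IH(1)[OF that]) (use that in \<open>intro Minimize.prems UN_I[of m]; simp\<close>)
  moreover have "run B p (pair x n) 0 (Q n)"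
    by (rule Minimize.IH(2)) (use Minimize.prems in auto)
  ultimately show ?case by (rule run.Minimize)
qed (auto intro: run.intros)

lemma partial_search:
  assumes "dec (\<lambda>z. P (pfst z) (psnd z))" "cmp (\<lambda>z. S (pfst z) (psnd z))"
  obtains p where "\<And>A x k. P x k \<Longrightarrow> run A p x (S x (LEAST m. P x m)) {}"
proof -
  obtain q where q: "\<And>A x k. P x k \<Longrightarrow> run A q x (LEAST m. P x m) {}"
    using partial_Least[OF assms(1)] by blast
  obtain r where r: "\<And>A z. run A r z (S (pfst z) (psnd z)) {}" using assms(2) by (rule cmpE) auto
  have "run A (Compose r (Pairing Ident q)) x (S x (LEAST m. P x m)) {}" if "P x k" for A x k
    using run_Compose[OF run_Pairing[OF run.Ident q[OF that]] r] by simp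
  then show thesis by (rule that)
qed

lemma ce_enumeration:
  assumes "ce W"
  obtains E where "cmp (\<lambda>z. E (pfst z) (psnd z))" "\<And>x. x \<in> W \<longleftrightarrow> (\<exists>s. 0 < E x s)"
    "\<And>x s s'. 0 < E x s \<Longrightarrow> s \<le> s' \<Longrightarrow> 0 < E x s'"
proof -
  obtain e where e: "W = {x. \<exists>y. phi {} e x y}" using assms unfolding ce_def by blast
  obtain p where p: "code p = e" using bij_code by (metis bij_pointE)
  have phi: "phi {} e x y \<longleftrightarrow> (\<exists>Q. run {} p x y Q)" for x y
    unfolding phi_def using p by (metis bij_code bij_is_inj injD)
  have W: "x \<in> W \<longleftrightarrow> (\<exists>s. 0 < ev p 0 x s)" for x
    unfolding e phi by simp (metis ev_sound ev_complete gr0_conv_Suc set_decode_zero)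
  have "cmp (\<lambda>z. ev p 0 (pfst z) (psnd z))" by (intro cmp_intros)
  moreover have "0 < ev p 0 x s'" if "0 < ev p 0 x s" "s \<le> s'" for x s s'
    using that ev_mono by (metis gr0_conv_Suc)
  ultimately show thesis using that W by blast
qed

lemma set_encode_initial: "set_encode {x. x < t \<and> P x} = (\<Sum>x<t. of_bool (P x) * 2 ^ x)"
proof -
  have "(\<Sum>x<t. of_bool (P x) * 2 ^ x) = (\<Sum>x<t. if P x then 2 ^ x else (0::nat))"
    by (rule sum.cong) auto
  also have "\<dots> = sum ((^) 2) {x. x < t \<and> P x}"
    by (simp add: sum.If_cases Int_def)
  finally show ?thesis unfolding set_encode_def by simp
qed

lemma cmp_set_encode [cmp_intros]:
  "dec (\<lambda>z. P (pfst z) (psnd z)) \<Longrightarrow> cmp t \<Longrightarrow> cmp (\<lambda>x. set_encode {k. k < t x \<and> P x k})"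
  unfolding set_encode_initial by (intro cmp_intros)

lemma initial_segment_program:
  obtains p where "\<And>Y t. \<exists>Q. run Y p t (set_encode {x. x < t \<and> x \<in> Y}) Q \<and> Q \<subseteq> {..<t}"
proof -
  have "cmp (\<lambda>z. psnd (pfst z) + psnd z * 2 ^ psnd (pfst (pfst z)))" by (intro cmp_intros)
  then obtain q where q: "\<And>Y z. run Y q z (psnd (pfst z) + psnd z * 2 ^ psnd (pfst (pfst z))) {}"
    by (rule cmpE) auto
  let ?st = "Compose q (Pairing Ident (Compose Oracle (Compose Second First)))"
  have st: "run Y ?st (pair (pair x n) a) (a + of_bool (n \<in> Y) * 2 ^ n) {n}" for Y x n a
  proof -
    have "run Y (Compose Second First) (pair (pair x n) a) n {}"
      by (rule run_Compose[OF run.First run.Second])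
    from run_Pairing[OF run.Ident run.Compose[OF this run.Oracle]]
    have "run Y (Pairing Ident (Compose Oracle (Compose Second First))) (pair (pair x n) a)
        (pair (pair (pair x n) a) (of_bool (n \<in> Y))) {n}" by simp
    from run.Compose[OF this q] show ?thesis by simp
  qed
  have "\<exists>Q. run Y (PrimRec Zero ?st) (pair x t) (set_encode {x. x < t \<and> x \<in> Y}) Q \<and> Q \<subseteq> {..<t}" for Y x t
  proof (induction t)
    case 0
    then show ?case using run.PrimRec_0[OF run.Zero[of Y x], of ?st] by auto
  next
    case (Suc t)
    then obtain Q where Q: "run Y (PrimRec Zero ?st) (pair x t) (set_encode {x. x < t \<and> x \<in> Y}) Q"
      "Q \<subseteq> {..<t}" by blast
    from run.PrimRec_Suc[OF Q(1) st] have
      "run Y (PrimRec Zero ?st) (pair x (Suc t)) (set_encode {x. x < Suc t \<and> x \<in> Y}) (Q \<union> {t})"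
      unfolding set_encode_initial by simp
    with Q(2) show ?case by (intro exI[of _ "Q \<union> {t}"]) auto
  qed
  then have "\<exists>Q. run Y (Compose (PrimRec Zero ?st) (Pairing Zero Ident)) t
      (set_encode {x. x < t \<and> x \<in> Y}) Q \<and> Q \<subseteq> {..<t}" for Y t
    by (metis run_Compose run_Pairing run.Zero run.Ident)
  then show thesis by (rule that)
qed

text \<open>Supplies the program behind the boxes: with oracle \<open>A\<close> it looks for the
  first relevant stage whose guess is a true initial segment of \<open>A\<close>, and outputs that
  guess.\<close>

lemma oracle_search:
  assumes R: "dec (\<lambda>z. R (pfst z) (psnd z))" and t: "cmp (\<lambda>z. t (pfst z) (psnd z))"
    and S: "cmp (\<lambda>z. S (pfst z) (psnd z))"
  obtains p where "\<And>A x k. \<lbrakk>R x k; S x k = set_encode {y. y < t x k \<and> y \<in> A};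
      \<And>m. \<lbrakk>m < k; R x m\<rbrakk> \<Longrightarrow> S x m \<noteq> set_encode {y. y < t x m \<and> y \<in> A}\<rbrakk>
      \<Longrightarrow> \<exists>Q. run A p x (S x k) Q"
proof -
  obtain i where i: "\<And>A t. \<exists>Q. run A i t (set_encode {x. x < t \<and> x \<in> A}) Q"
    using initial_segment_program by metis
  obtain tp where tp: "\<And>A z. run A tp z (t (pfst z) (psnd z)) {}" using t by (rule cmpE) auto
  obtain sp where sp: "\<And>A z. run A sp z (S (pfst z) (psnd z)) {}" using S by (rule cmpE) auto
  note RS = cmp_comp2[of "\<lambda>u v. of_bool (R u v)", OF R] cmp_comp2[of S, OF S]
  have "dec (\<lambda>w. \<not> (R (pfst (pfst w)) (psnd (pfst w)) \<and> S (pfst (pfst w)) (psnd (pfst w)) = psnd w))"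
    by (intro cmp_intros RS)
  then obtain c where c: "\<And>A w. run A c w
      (of_bool (\<not> (R (pfst (pfst w)) (psnd (pfst w)) \<and> S (pfst (pfst w)) (psnd (pfst w)) = psnd w))) {}"
    by (rule cmpE) auto
  define q where "q = Compose c (Pairing Ident (Compose i tp))"
  have q: "\<exists>Q. run A q (pair x k)
      (of_bool (\<not> (R x k \<and> S x k = set_encode {y. y < t x k \<and> y \<in> A}))) Q" for A x k
  proof -
    have tx: "run A tp (pair x k) (t x k) {}" using tp[of A "pair x k"] by simp
    obtain Q where "run A i (t x k) (set_encode {y. y < t x k \<and> y \<in> A}) Q" using i by blast
    from run.Compose[OF run_Pairing[OF run.Ident run_Compose[OF tx this]] c] show ?thesis unfolding q_def by auto
  qed
  have "\<exists>Q. run A (Compose sp (Pairing Ident (Minimize q))) x (S x k) Q"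
    if k: "R x k" "S x k = set_encode {y. y < t x k \<and> y \<in> A}"
      and less: "\<And>m. \<lbrakk>m < k; R x m\<rbrakk> \<Longrightarrow> S x m \<noteq> set_encode {y. y < t x m \<and> y \<in> A}" for A x k
  proof -
    obtain Q where Q: "\<And>m. run A q (pair x m)
        (of_bool (\<not> (R x m \<and> S x m = set_encode {y. y < t x m \<and> y \<in> A}))) (Q m)"
      using q by metis
    have "run A q (pair x m) (Suc 0) (Q m)" if "m < k" for m
      using Q[of m] less[OF that] by auto
    moreover have "run A q (pair x k) 0 (Q k)" using Q[of k] k by simp
    ultimately have "run A (Minimize q) x k (\<Union>m\<le>k. Q m)" by (rule run.Minimize)
    from run.Compose[OF run_Pairing[OF run.Ident this] sp] show ?thesis by auto
  qed
  then show thesis by (rule that)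
qed

section \<open>Programs that receive their own index\<close>

definition const_code :: "nat \<Rightarrow> nat" where
  "const_code c = code (Const c)"

lemma cmp_const_code [cmp_intros]: "cmp f \<Longrightarrow> cmp (\<lambda>x. const_code (f x))"
proof -
  \<comment> \<open>\<open>7 + 4 * pair 1 r\<close> is the code of \<open>Compose Succ p\<close>
    when \<open>r\<close> is the code of \<open>p\<close>.\<close>
  have "const_code c = rec_nat 0 (\<lambda>k r. 7 + 4 * pair 1 r) c" for c
    unfolding const_code_def by (induction c) auto
  moreover have "cmp (\<lambda>x. rec_nat 0 (\<lambda>k r. 7 + 4 * pair 1 r) (f x))" if "cmp f"
    by (intro cmp_rec cmp_intros that)
  ultimately show "cmp f \<Longrightarrow> ?thesis" by simp
qed

text \<open>The program with index \<open>diag q c\<close> hands its input to the program \<open>q\<close>; on the input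
  \<open>diag q c\<close> it thus knows its own index.\<close>

definition diag :: "nat \<Rightarrow> nat \<Rightarrow> nat" where
  "diag e c = 7 + 4 * pair e (6 + 4 * pair 2 (const_code c))"

text \<open>Takes the place of the recursion theorem: a program started through \<open>diag\<close>
  can read its own code off the index that it receives.\<close>

lemma diag_program: "pfst ((diag e c - 7) div 4) = e"
  unfolding diag_def by simp

lemma cmp_diag [cmp_intros]: "cmp f \<Longrightarrow> cmp g \<Longrightarrow> cmp (\<lambda>x. diag (f x) (g x))"
  unfolding diag_def by (intro cmp_intros)

lemma phi_diag:
  assumes "run A p (pair (diag (code p) c) c) y Q"
  shows "phi A (diag (code p) c) (diag (code p) c) y"
proof -
  have "code (Compose p (Pairing Ident (Const c))) = diag (code p) c"
    unfolding diag_def const_code_def by simp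
  moreover have "run A (Compose p (Pairing Ident (Const c))) (diag (code p) c) y Q"
    by (rule run_Compose[OF run_Pairing[OF run.Ident run_Const] assms])
  ultimately show ?thesis unfolding phi_def by blast
qed

subsection \<open>The box promotion construction\<close>

text \<open>Intended meaning: \<open>EA x a\<close> and \<open>ET w a\<close> are positive once
  \<open>x\<close> is in \<open>A\<close>, or \<open>w\<close> in the coded trace, by stage
  \<open>a\<close>; \<open>yd a\<close> is the canonical index of the approximation to
  \<open>Y\<close>; \<open>V n\<close> bounds a use; \<open>C n\<close> exceeds every epoch of level
  \<open>n\<close>.\<close>

locale promotion =
  fixes EA :: "nat \<Rightarrow> nat \<Rightarrow> nat"
    and yd :: "nat \<Rightarrow> nat"
    and V C :: "nat \<Rightarrow> nat"
    and ET :: "nat \<Rightarrow> nat \<Rightarrow> nat"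
begin

definition seg :: "nat \<Rightarrow> nat \<Rightarrow> nat" where
  "seg t a = set_encode {x. x < t \<and> 0 < EA x a}"

definition yc :: "nat \<Rightarrow> nat \<Rightarrow> nat" where
  "yc n a = (\<Sum>q<a. of_bool (\<not> (\<forall>z<V n. (z \<in> set_decode (yd (Suc q))) = (z \<in> set_decode (yd q)))))"

definition cc :: "nat set \<Rightarrow> nat \<Rightarrow> nat" where
  "cc G a = (\<Sum>q<a. of_bool (q \<in> G))"

text \<open>
  \<open>G\<close> is the set of good stages, at which all pending tests have been confirmed by the trace. The
  state of level \<open>n\<close> consists of the last good stage \<open>l\<close> (encoded as \<open>Suc l\<close>, and \<open>0\<close> if there is none),
  the length \<open>t\<close> of the tested segment of \<open>A\<close>, the number \<open>k\<close> of failed tests, and the number \<open>h\<close> whose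
  first \<open>k\<close> digits in base \<open>C n\<close> are the epochs of these failures. The functions \<open>lb\<close>, \<open>tb\<close>, \<open>kb\<close>, \<open>hb\<close> give
  the state before stage \<open>a\<close>, and \<open>tc\<close>, \<open>kc\<close>, \<open>hc\<close> the state at stage \<open>a\<close> if that stage becomes good.
  Epochs are counted by the changes \<open>yc\<close> of \<open>Y\<close> at all stages, not only at good ones, so that a change
  seen at a stage that does not become good is never forgotten. Only levels up to the number \<open>cc\<close> of
  earlier good stages are active, so finitely many tests are pending at a time.
\<close>

primrec lb :: "nat set \<Rightarrow> nat \<Rightarrow> nat \<Rightarrow> nat" where
  "lb G n 0 = 0"
| "lb G n (Suc a) = (if a \<in> G \<and> n \<le> cc G a then Suc a else lb G n a)"

text \<open>If positive, \<open>l\<close> is one more than the last good stage. The reduction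
  answers \<open>x\<close> at a good stage beyond \<open>x\<close>, so the length \<open>l\<close>
  covers every input answered by then, whose protection the change of \<open>Y\<close> may have
  destroyed.\<close>

definition t_step :: "nat \<Rightarrow> nat \<Rightarrow> nat \<Rightarrow> nat \<Rightarrow> nat" where
  "t_step n l t a = (if 0 < l \<and> yc n a \<noteq> yc n (l - 1) then max t l else t)"

primrec tb :: "nat set \<Rightarrow> nat \<Rightarrow> nat \<Rightarrow> nat" where
  "tb G n 0 = V n"
| "tb G n (Suc a) = (if a \<in> G \<and> n \<le> cc G a then t_step n (lb G n a) (tb G n a) a else tb G n a)"

definition tc :: "nat set \<Rightarrow> nat \<Rightarrow> nat \<Rightarrow> nat" where
  "tc G n a = t_step n (lb G n a) (tb G n a) a"

definition fails :: "nat set \<Rightarrow> nat \<Rightarrow> nat \<Rightarrow> bool" where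
  "fails G n a \<longleftrightarrow> 0 < lb G n a \<and> seg (tb G n a) a \<noteq> seg (tb G n a) (lb G n a - 1)"

primrec kb :: "nat set \<Rightarrow> nat \<Rightarrow> nat \<Rightarrow> nat" where
  "kb G n 0 = 0"
| "kb G n (Suc a) = (if a \<in> G \<and> n \<le> cc G a then kb G n a + of_bool (fails G n a) else kb G n a)"

definition kc :: "nat set \<Rightarrow> nat \<Rightarrow> nat \<Rightarrow> nat" where
  "kc G n a = kb G n a + of_bool (fails G n a)"

text \<open>The failed test is the one confirmed at the last good stage, so the new digit is the
  epoch of that stage and not of \<open>a\<close>.\<close>

definition h_step :: "nat set \<Rightarrow> nat \<Rightarrow> nat \<Rightarrow> nat \<Rightarrow> nat" where
  "h_step G n h a = h + of_bool (fails G n a) * (yc n (lb G n a - 1) * C n ^ kb G n a)"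

primrec hb :: "nat set \<Rightarrow> nat \<Rightarrow> nat \<Rightarrow> nat" where
  "hb G n 0 = 0"
| "hb G n (Suc a) = (if a \<in> G \<and> n \<le> cc G a then h_step G n (hb G n a) a else hb G n a)"

definition hc :: "nat set \<Rightarrow> nat \<Rightarrow> nat \<Rightarrow> nat" where
  "hc G n a = h_step G n (hb G n a) a"

definition uses_box :: "nat set \<Rightarrow> nat \<Rightarrow> nat \<Rightarrow> nat \<Rightarrow> bool" where
  "uses_box G n m a \<longleftrightarrow> m mod C n ^ Suc (kc G n a) = hc G n a + yc n a * C n ^ kc G n a"

text \<open>The exponent \<open>n + 2\<close> leaves room for at most \<open>n + 1\<close> failures
  and the current epoch. Levels below \<open>e\<close> are exempt because the size of the trace is
  controlled only from level \<open>e\<close> on.\<close>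

definition good :: "nat set \<Rightarrow> nat \<Rightarrow> nat \<Rightarrow> bool" where
  "good G e a \<longleftrightarrow> (\<forall>n\<le>cc G a. e \<le> n \<longrightarrow> (\<forall>m<C n ^ (n + 2). uses_box G n m a \<longrightarrow>
     0 < ET (pair (diag e (pair n m)) (seg (tc G n a) a)) a))"

text \<open>Goodness of a stage depends on all earlier good stages; carrying them along as a
  canonical index turns this into primitive recursion.\<close>

primrec good_code :: "nat \<Rightarrow> nat \<Rightarrow> nat" where
  "good_code e 0 = 0"
| "good_code e (Suc a) = good_code e a + of_bool (good (set_decode (good_code e a)) e a) * 2 ^ a"

definition goods :: "nat \<Rightarrow> nat set" where
  "goods e = {a. good (set_decode (good_code e a)) e a}"

lemma set_decode_good_code: "set_decode (good_code e a) = {q. q < a \<and> q \<in> goods e}"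
proof -
  have "good_code e a = set_encode {q. q < a \<and> q \<in> goods e}"
    unfolding set_encode_initial by (induction a) (auto simp: goods_def)
  then show ?thesis by simp
qed

text \<open>Each recursion looks only at good stages before the current one, so a program may work
  with the finite part given by \<open>good_code\<close>.\<close>

lemma local_state:
  assumes "\<And>q. q < a \<Longrightarrow> q \<in> G \<longleftrightarrow> q \<in> H"
  shows "cc G a = cc H a" "lb G n a = lb H n a" "tb G n a = tb H n a" "kb G n a = kb H n a"
    "hb G n a = hb H n a" "fails G n a = fails H n a" "tc G n a = tc H n a" "kc G n a = kc H n a"
    "hc G n a = hc H n a"
proof -
  have cc: "cc G b = cc H b" if "b \<le> a" for b
    unfolding cc_def using assms that by (intro sum.cong) auto
  have lb: "lb G n b = lb H n b" if "b \<le> a" for b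
    using that by (induction b) (auto simp: cc assms)
  have tb: "tb G n b = tb H n b" if "b \<le> a" for b
    using that by (induction b) (auto simp: cc lb assms)
  have fails: "fails G n b = fails H n b" if "b \<le> a" for b
    using that unfolding fails_def by (simp add: lb tb)
  have kb: "kb G n b = kb H n b" if "b \<le> a" for b
    using that by (induction b) (auto simp: cc fails assms)
  have hb: "hb G n b = hb H n b" if "b \<le> a" for b
    using that by (induction b) (auto simp: cc fails kb lb h_step_def assms)
  show "cc G a = cc H a" "lb G n a = lb H n a" "tb G n a = tb H n a" "kb G n a = kb H n a"
    "hb G n a = hb H n a" "fails G n a = fails H n a" "tc G n a = tc H n a" "kc G n a = kc H n a"
    "hc G n a = hc H n a"
    by (simp_all add: cc lb tb fails kb hb tc_def kc_def hc_def h_step_def)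
qed

lemma uses_box_local:
  assumes "\<And>q. q < a \<Longrightarrow> q \<in> G \<longleftrightarrow> q \<in> H"
  shows "uses_box G n m a = uses_box H n m a"
  unfolding uses_box_def by (simp only: local_state(8,9)[of a G H, OF assms])

lemma goods_iff: "a \<in> goods e \<longleftrightarrow> good (goods e) e a"
proof -
  have eq: "q < a \<Longrightarrow> q \<in> set_decode (good_code e a) \<longleftrightarrow> q \<in> goods e" for q
    unfolding set_decode_good_code by simp
  have "a \<in> goods e \<longleftrightarrow> good (set_decode (good_code e a)) e a" unfolding goods_def by simp
  also have "\<dots> = good (goods e) e a"
    unfolding good_def
    by (simp only: local_state[of a _ "goods e", OF eq] uses_box_local[of a _ "goods e", OF eq])
  finally show ?thesis .
qed

end

section \<open>Computability of the construction\<close>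

locale computable_promotion = promotion +
  assumes EA0: "cmp (\<lambda>z. EA (pfst z) (psnd z))"
    and yd0: "cmp yd" and V0: "cmp V" and C0: "cmp C"
    and ET0: "cmp (\<lambda>z. ET (pfst z) (psnd z))"
begin

lemmas cmp_params = cmp_comp2[OF EA0] cmp_comp[OF yd0] cmp_comp[OF V0] cmp_comp[OF C0] cmp_comp2[OF ET0]

lemma cmp_seg: "cmp f \<Longrightarrow> cmp g \<Longrightarrow> cmp (\<lambda>x. seg (f x) (g x))"
  by (rule cmp_comp2[of seg]) (unfold seg_def, intro cmp_intros cmp_params)

lemma cmp_yc: "cmp f \<Longrightarrow> cmp g \<Longrightarrow> cmp (\<lambda>x. yc (f x) (g x))"
  by (rule cmp_comp2[of yc]) (unfold yc_def, intro cmp_intros cmp_params)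

lemma cmp_cc: "cmp f \<Longrightarrow> cmp g \<Longrightarrow> cmp (\<lambda>x. cc (set_decode (f x)) (g x))"
  by (rule cmp_comp2[of "\<lambda>u v. cc (set_decode u) v"]) (unfold cc_def, intro cmp_intros cmp_params)

lemma cmp_lb: "cmp f \<Longrightarrow> cmp g \<Longrightarrow> cmp h \<Longrightarrow> cmp (\<lambda>x. lb (set_decode (f x)) (g x) (h x))"
proof (rule cmp_comp3[of "\<lambda>u v w. lb (set_decode u) v w"])
  have "lb G n a = rec_nat 0 (\<lambda>k r. if k \<in> G \<and> n \<le> cc G k then Suc k else r) a" for G n a
    by (induction a) auto
  then show "cmp (\<lambda>z. lb (set_decode (pfst (pfst z))) (psnd (pfst z)) (psnd z))"
    by (simp only:) (intro cmp_rec cmp_intros cmp_cc)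
qed

lemma cmp_t_step:
  "cmp f \<Longrightarrow> cmp g \<Longrightarrow> cmp h \<Longrightarrow> cmp k \<Longrightarrow> cmp (\<lambda>x. t_step (f x) (g x) (h x) (k x))"
  unfolding t_step_def by (intro cmp_intros cmp_yc)

lemma cmp_tb: "cmp f \<Longrightarrow> cmp g \<Longrightarrow> cmp h \<Longrightarrow> cmp (\<lambda>x. tb (set_decode (f x)) (g x) (h x))"
proof (rule cmp_comp3[of "\<lambda>u v w. tb (set_decode u) v w"])
  have "tb G n a = rec_nat (V n) (\<lambda>k r. if k \<in> G \<and> n \<le> cc G k then t_step n (lb G n k) r k else r) a"
    for G n a by (induction a) auto
  then show "cmp (\<lambda>z. tb (set_decode (pfst (pfst z))) (psnd (pfst z)) (psnd z))"
    by (simp only:) (intro cmp_rec cmp_intros cmp_cc cmp_lb cmp_t_step cmp_params)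
qed

lemma cmp_tc: "cmp f \<Longrightarrow> cmp g \<Longrightarrow> cmp h \<Longrightarrow> cmp (\<lambda>x. tc (set_decode (f x)) (g x) (h x))"
  unfolding tc_def by (intro cmp_t_step cmp_lb cmp_tb)

lemma dec_fails: "cmp f \<Longrightarrow> cmp g \<Longrightarrow> cmp h \<Longrightarrow> dec (\<lambda>x. fails (set_decode (f x)) (g x) (h x))"
  unfolding fails_def by (intro cmp_intros cmp_lb cmp_tb cmp_seg)

lemma cmp_kb: "cmp f \<Longrightarrow> cmp g \<Longrightarrow> cmp h \<Longrightarrow> cmp (\<lambda>x. kb (set_decode (f x)) (g x) (h x))"
proof (rule cmp_comp3[of "\<lambda>u v w. kb (set_decode u) v w"])
  have "kb G n a = rec_nat 0 (\<lambda>k r. if k \<in> G \<and> n \<le> cc G k then r + of_bool (fails G n k) else r) a"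
    for G n a by (induction a) auto
  then show "cmp (\<lambda>z. kb (set_decode (pfst (pfst z))) (psnd (pfst z)) (psnd z))"
    by (simp only:) (intro cmp_rec cmp_intros cmp_cc dec_fails)
qed

lemma cmp_kc: "cmp f \<Longrightarrow> cmp g \<Longrightarrow> cmp h \<Longrightarrow> cmp (\<lambda>x. kc (set_decode (f x)) (g x) (h x))"
  unfolding kc_def by (intro cmp_intros cmp_kb dec_fails)

lemma cmp_h_step:
  "cmp f \<Longrightarrow> cmp g \<Longrightarrow> cmp h \<Longrightarrow> cmp k \<Longrightarrow> cmp (\<lambda>x. h_step (set_decode (f x)) (g x) (h x) (k x))"
  unfolding h_step_def by (intro cmp_intros cmp_yc cmp_kb cmp_lb dec_fails cmp_params)

lemma cmp_hb: "cmp f \<Longrightarrow> cmp g \<Longrightarrow> cmp h \<Longrightarrow> cmp (\<lambda>x. hb (set_decode (f x)) (g x) (h x))"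
proof (rule cmp_comp3[of "\<lambda>u v w. hb (set_decode u) v w"])
  have "hb G n a = rec_nat 0 (\<lambda>k r. if k \<in> G \<and> n \<le> cc G k then h_step G n r k else r) a"
    for G n a by (induction a) auto
  then show "cmp (\<lambda>z. hb (set_decode (pfst (pfst z))) (psnd (pfst z)) (psnd z))"
    by (simp only:) (intro cmp_rec cmp_intros cmp_cc cmp_h_step)
qed

lemma cmp_hc: "cmp f \<Longrightarrow> cmp g \<Longrightarrow> cmp h \<Longrightarrow> cmp (\<lambda>x. hc (set_decode (f x)) (g x) (h x))"
  unfolding hc_def by (intro cmp_h_step cmp_hb)

lemma dec_uses_box: "cmp f \<Longrightarrow> cmp g \<Longrightarrow> cmp h \<Longrightarrow> cmp k \<Longrightarrow>
    dec (\<lambda>x. uses_box (set_decode (f x)) (g x) (h x) (k x))"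
  unfolding uses_box_def by (intro cmp_intros cmp_kc cmp_hc cmp_yc cmp_params)

lemma dec_good: "cmp f \<Longrightarrow> cmp g \<Longrightarrow> cmp h \<Longrightarrow> dec (\<lambda>x. good (set_decode (f x)) (g x) (h x))"
  by (rule cmp_comp3[of "\<lambda>u v w. of_bool (good (set_decode u) v w)"], unfold good_def,
      intro cmp_intros cmp_cc dec_uses_box cmp_tc cmp_seg cmp_params)

lemma cmp_good_code: "cmp f \<Longrightarrow> cmp g \<Longrightarrow> cmp (\<lambda>x. good_code (f x) (g x))"
proof (rule cmp_comp2[of good_code])
  have "good_code e a = rec_nat 0 (\<lambda>k r. r + of_bool (good (set_decode r) e k) * 2 ^ k) a"
    for e a by (induction a) auto
  then show "cmp (\<lambda>z. good_code (pfst z) (psnd z))"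
    by (simp only:) (intro cmp_rec cmp_intros dec_good)
qed

lemmas cmp_construction = cmp_seg cmp_yc cmp_cc cmp_lb cmp_tb cmp_tc dec_fails cmp_kb cmp_kc cmp_hc
  dec_uses_box cmp_good_code cmp_params

end

section \<open>Bounding the number of failed tests\<close>

locale traced_promotion = promotion EA yd V C ET
  for EA :: "nat \<Rightarrow> nat \<Rightarrow> nat" and yd :: "nat \<Rightarrow> nat" and V C :: "nat \<Rightarrow> nat"
    and ET :: "nat \<Rightarrow> nat \<Rightarrow> nat" +
  fixes A :: "nat set" and T :: "nat \<Rightarrow> nat set" and e :: nat and G :: "nat set"
  assumes A_iff: "x \<in> A \<longleftrightarrow> (\<exists>a. 0 < EA x a)"
    and EA_mono: "0 < EA x a \<Longrightarrow> a \<le> b \<Longrightarrow> 0 < EA x b"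
    and T_iff: "y \<in> T j \<longleftrightarrow> (\<exists>a. 0 < ET (pair j y) a)"
    and ET_mono: "0 < ET w a \<Longrightarrow> a \<le> b \<Longrightarrow> 0 < ET w b"
    and yc_less: "yc n a < C n"
    and V_ge: "n \<le> V n"
    and finite_T: "finite (T j)"
    and card_T: "e \<le> n \<Longrightarrow> m < C n ^ (n + 2) \<Longrightarrow> card (T (diag e (pair n m))) \<le> Suc n"
    and G_iff: "a \<in> G \<longleftrightarrow> good G e a"
    \<comment> \<open>What the box programs provide: the first correct test put into a box is the
      value of the jump there, and hence is traced.\<close>
    and box_value: "\<And>n m a. \<lbrakk>n \<le> cc G a; uses_box G n m a; seg (tc G n a) a = set_encode {x. x < tc G n a \<and> x \<in> A};
      \<And>b. \<lbrakk>b < a; n \<le> cc G b; uses_box G n m b\<rbrakk> \<Longrightarrow> seg (tc G n b) b \<noteq> set_encode {x. x < tc G n b \<and> x \<in> A}\<rbrakk>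
      \<Longrightarrow> seg (tc G n a) a \<in> T (diag e (pair n m))"
begin

abbreviation settled :: "nat \<Rightarrow> nat \<Rightarrow> bool" where
  "settled t a \<equiv> seg t a = set_encode {x. x < t \<and> x \<in> A}"

lemma seg_eq_iff: "seg t a = seg t b \<longleftrightarrow> (\<forall>x<t. 0 < EA x a \<longleftrightarrow> 0 < EA x b)"
proof -
  have "seg t a = seg t b \<longleftrightarrow> {x. x < t \<and> 0 < EA x a} = {x. x < t \<and> 0 < EA x b}"
    unfolding seg_def by (intro set_encode_eq) auto
  then show ?thesis by blast
qed

lemma settled_iff: "settled t a \<longleftrightarrow> (\<forall>x<t. x \<in> A \<longrightarrow> 0 < EA x a)"
proof -
  have "settled t a \<longleftrightarrow> {x. x < t \<and> 0 < EA x a} = {x. x < t \<and> x \<in> A}"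
    unfolding seg_def by (intro set_encode_eq) auto
  then show ?thesis using A_iff by blast
qed

lemma cc_Suc: "cc G (Suc a) = cc G a + of_bool (a \<in> G)"
  unfolding cc_def by simp

lemma cc_mono: "a \<le> b \<Longrightarrow> cc G a \<le> cc G b"
  unfolding cc_def by (intro sum_mono2) auto

lemma yc_mono: "a \<le> b \<Longrightarrow> yc n a \<le> yc n b"
  unfolding yc_def by (intro sum_mono2) auto

lemma cc_le: "cc G a \<le> a"
  by (induction a) (auto simp: cc_Suc, simp add: cc_def)

lemma state_at_last:
  assumes "lb G n a = Suc l"
  shows "l < a" "l \<in> G" "n \<le> cc G l" "tb G n a = tc G n l" "kb G n a = kc G n l" "hb G n a = hc G n l"
  using assms by (induction a) (auto simp: tc_def kc_def hc_def split: if_splits)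

lemma state_initial:
  assumes "lb G n a = 0"
  shows "tb G n a = V n" "kb G n a = 0" "hb G n a = 0"
  using assms by (induction a) (auto split: if_splits)

lemma not_fails_initial: "lb G n a = 0 \<Longrightarrow> \<not> fails G n a"
  unfolding fails_def by simp

lemma state_between:
  assumes "a \<le> b" "\<And>q. a \<le> q \<Longrightarrow> q < b \<Longrightarrow> \<not> (q \<in> G \<and> n \<le> cc G q)"
  shows "lb G n b = lb G n a" "tb G n b = tb G n a" "kb G n b = kb G n a" "hb G n b = hb G n a"
  using assms by (induction b rule: dec_induct) auto

lemma lb_after:
  assumes "q < a" "q \<in> G" "n \<le> cc G q"
  obtains l where "lb G n a = Suc l" "q \<le> l"
proof -
  have "\<exists>l\<ge>q. lb G n a = Suc l"
    using assms by (induction a) (auto simp: less_Suc_eq)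
  then show thesis using that by blast
qed

lemma last_cases:
  assumes "p \<le> a"
  obtains (same) "lb G n a = lb G n p" "tb G n a = tb G n p" "kb G n a = kb G n p" "hb G n a = hb G n p"
    | (later) l where "lb G n a = Suc l" "p \<le> l"
proof (cases "\<exists>q. p \<le> q \<and> q < a \<and> q \<in> G \<and> n \<le> cc G q")
  case False
  then show ?thesis by (intro same state_between assms) auto
next
  case True
  then obtain q where q: "p \<le> q" "q < a" "q \<in> G" "n \<le> cc G q" by blast
  obtain l where "lb G n a = Suc l" "q \<le> l" using lb_after[OF q(2-4)] .
  with later q(1) show ?thesis by simp
qed

lemma tb_le_tc: "tb G n a \<le> tc G n a"
  unfolding tc_def t_step_def by auto

lemma V_le_tb: "V n \<le> tb G n a"
  by (induction a) (auto simp: t_step_def)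

lemma kb_mono: "a \<le> b \<Longrightarrow> kb G n a \<le> kb G n b"
  by (induction rule: dec_induct) auto

lemma tb_mono: "a \<le> b \<Longrightarrow> tb G n a \<le> tb G n b"
  by (induction rule: dec_induct) (auto simp: t_step_def)

text \<open>Epochs are below \<open>C n\<close> and thus legitimate digits; appending one causes no
  carry.\<close>

lemma hc_less: "hc G n a < C n ^ kc G n a"
proof -
  have step: "h_step G n h a < C n ^ (kb G n a + of_bool (fails G n a))" if "h < C n ^ kb G n a" for h a
  proof (cases "fails G n a")
    case True
    have "Suc (yc n (lb G n a - 1)) * C n ^ kb G n a \<le> C n * C n ^ kb G n a"
      using yc_less by (intro mult_right_mono) (auto simp: Suc_le_eq)
    with True that show ?thesis by (simp add: h_step_def)
  qed (use that in \<open>simp add: h_step_def\<close>)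
  have hb: "hb G n a < C n ^ kb G n a" for a
    by (induction a) (auto simp: step simp del: of_bool_eq_iff)
  show "hc G n a < C n ^ kc G n a" unfolding hc_def kc_def by (rule step[OF hb])
qed

lemma C_pos: "0 < C n"
  using yc_less[of n 0] by simp

lemma next_digit_less: "h < C n ^ k \<Longrightarrow> h + yc n a * C n ^ k < C n ^ Suc k"
proof -
  assume "h < C n ^ k"
  moreover have "Suc (yc n a) * C n ^ k \<le> C n * C n ^ k"
    using yc_less by (intro mult_right_mono) (auto simp: Suc_le_eq)
  ultimately show ?thesis by simp
qed

lemma mod_shorter_prefix:
  fixes c :: nat
  assumes "m mod c ^ k = r mod c ^ k" "j \<le> k"
  shows "m mod c ^ j = r mod c ^ j"
  by (metis assms le_imp_power_dvd mod_mod_cancel)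

lemma uses_box_mod:
  assumes "uses_box G n m a"
  shows "m mod C n ^ kc G n a = hc G n a"
proof -
  have "m mod C n ^ Suc (kc G n a) = (hc G n a + yc n a * C n ^ kc G n a) mod C n ^ Suc (kc G n a)"
    using assms next_digit_less[OF hc_less, of n a a] unfolding uses_box_def by simp
  from mod_shorter_prefix[OF this, of "kc G n a"] show ?thesis
    using hc_less[of n a] by simp
qed

lemma kc_hc_at_last:
  assumes "lb G n a = Suc l"
  shows "kc G n a = kc G n l + of_bool (fails G n a)"
    "hc G n a = hc G n l + of_bool (fails G n a) * (yc n l * C n ^ kc G n l)"
  using state_at_last[OF assms] assms unfolding kc_def[of G n a] hc_def[of G n a] h_step_def by auto

text \<open>A failed test leaves in each of its boxes an element that is no initial segment of \<open>A\<close> any more.\<close>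

lemma wasted_elements:
  assumes "e \<le> n" "m < C n ^ (n + 2)" "m mod C n ^ kc G n a = hc G n a"
  shows "\<exists>W\<subseteq>T (diag e (pair n m)). card W = kc G n a \<and>
    (\<forall>d\<in>W. set_decode d \<subset> {x. x < tc G n a \<and> 0 < EA x a})"
  using assms(3)
proof (induction a rule: less_induct)
  case (less a)
  show ?case
  proof (cases "lb G n a")
    case 0
    then have "kc G n a = 0" using state_initial[OF 0] not_fails_initial[OF 0] unfolding kc_def by simp
    then show ?thesis by (intro exI[of _ "{}"]) auto
  next
    case (Suc l)
    note last = state_at_last[OF Suc] kc_hc_at_last[OF Suc]
    have ext: "{x. x < tc G n l \<and> 0 < EA x l} \<subseteq> {x. x < tc G n a \<and> 0 < EA x a}"
      using last(1,4) tb_le_tc[of n a] EA_mono[of _ l a] by auto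
    show ?thesis
    proof (cases "fails G n a")
      case False
      with last have "kc G n a = kc G n l" "hc G n a = hc G n l" by auto
      with less last(1) obtain W where "W \<subseteq> T (diag e (pair n m))" "card W = kc G n a"
        "\<forall>d\<in>W. set_decode d \<subset> {x. x < tc G n l \<and> 0 < EA x l}" by metis
      with ext show ?thesis by (meson psubset_subset_trans)
    next
      case True
      let ?v = "seg (tc G n l) l"
      have v: "set_decode ?v = {x. x < tc G n l \<and> 0 < EA x l}" unfolding seg_def by simp
      from True last have k: "kc G n a = Suc (kc G n l)"
        and h: "hc G n a = hc G n l + yc n l * C n ^ kc G n l" by auto
      \<comment> \<open>The epoch of \<open>l\<close> became the last digit at this failure. So
        \<open>m\<close> was a box of the test at \<open>l\<close>, and since \<open>l\<close> is
        good, the tested value is in its trace.\<close>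
      from less.prems have u: "uses_box G n m l" unfolding uses_box_def k h .
      obtain W where W: "W \<subseteq> T (diag e (pair n m))" "card W = kc G n l"
        "\<forall>d\<in>W. set_decode d \<subset> {x. x < tc G n l \<and> 0 < EA x l}"
        using less.IH[OF last(1) uses_box_mod[OF u]] by blast
      have "?v \<in> T (diag e (pair n m))"
        using last(2,3) u assms(1,2) unfolding G_iff good_def T_iff by blast
      \<comment> \<open>The earlier wasted elements code proper subsets of the segment tested at
        \<open>l\<close>, so this one is new.\<close>
      moreover have "?v \<notin> W" using W(3) v by blast
      moreover have "finite W" using W(1) finite_T finite_subset by blast
      ultimately have "insert ?v W \<subseteq> T (diag e (pair n m))" "card (insert ?v W) = kc G n a"
        using W k by auto
      moreover have "set_decode ?v \<subset> {x. x < tc G n a \<and> 0 < EA x a}"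
      proof -
        obtain x where "x < tc G n l" "\<not> 0 < EA x l" "0 < EA x a"
          using True Suc last(1,4) EA_mono unfolding fails_def seg_eq_iff
          by (metis diff_Suc_1 less_imp_le)
        then have "x \<in> {x. x < tc G n a \<and> 0 < EA x a}" "x \<notin> set_decode ?v"
          using v tb_le_tc[of n a] last(4) by simp_all
        then show ?thesis using ext v by blast
      qed
      ultimately show ?thesis using W(3) ext by (intro exI[of _ "insert ?v W"]) auto
    qed
  qed
qed

text \<open>At a good stage, a box of the current test traces the \<open>kc G n a\<close> wasted
  elements and also the current segment, all distinct, while its trace has at most
  \<open>n + 1\<close> elements.\<close>

lemma kc_good:
  assumes "e \<le> n" "a \<in> G" "n \<le> cc G a"
  shows "kc G n a \<le> n"
  using assms(2,3)
proof (induction a rule: less_induct)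
  case (less a)
  \<comment> \<open>The bound at the preceding good stage allows one new failure. This weaker
    estimate comes first, to ensure that the test has a box among those with \<open>n + 2\<close>
    digits.\<close>
  have le: "kc G n a \<le> Suc n"
  proof (cases "lb G n a")
    case 0
    then show ?thesis using state_initial[OF 0] unfolding kc_def by simp
  next
    case (Suc l)
    then show ?thesis using less.IH[of l] state_at_last[OF Suc] unfolding kc_def by simp
  qed
  \<comment> \<open>The box with the failure epochs and the current epoch as first digits, and 0
    elsewhere.\<close>
  define m where "m = hc G n a + yc n a * C n ^ kc G n a"
  have m: "m < C n ^ Suc (kc G n a)" unfolding m_def by (rule next_digit_less[OF hc_less])
  also have "\<dots> \<le> C n ^ (n + 2)" using le C_pos by (intro power_increasing) (auto simp: Suc_leI)
  finally have m2: "m < C n ^ (n + 2)" .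
  have u: "uses_box G n m a" using m unfolding uses_box_def m_def by simp
  let ?v = "seg (tc G n a) a"
  obtain W where W: "W \<subseteq> T (diag e (pair n m))" "card W = kc G n a"
    "\<forall>d\<in>W. set_decode d \<subset> {x. x < tc G n a \<and> 0 < EA x a}"
    using wasted_elements[OF assms(1) m2 uses_box_mod[OF u]] by blast
  have "?v \<in> T (diag e (pair n m))"
    using less.prems u assms(1) m2 unfolding G_iff good_def T_iff by blast
  moreover have "set_decode ?v = {x. x < tc G n a \<and> 0 < EA x a}" unfolding seg_def by simp
  then have "?v \<notin> W" using W(3) by blast
  moreover have "finite W" using W(1) finite_T finite_subset by blast
  ultimately have "Suc (kc G n a) \<le> card (T (diag e (pair n m)))"
    using W finite_T by (metis card_insert_disjoint card_mono insert_subset)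
  with card_T[OF assms(1) m2] show ?case by simp
qed

lemma kc_le:
  assumes "e \<le> n"
  shows "kc G n a \<le> Suc n"
proof (cases "lb G n a")
  case 0
  then show ?thesis using state_initial[OF 0] unfolding kc_def by simp
next
  case (Suc l)
  then show ?thesis using kc_good[OF assms, of l] state_at_last[OF Suc] unfolding kc_def by simp
qed

text \<open>Two tests that share a box and are not separated by a failure belong to the same epoch, so
  they concern initial segments of \<open>A\<close> of the same length. The first test is assumed to be correct,
  hence never failed.\<close>

lemma state_after_settled:
  assumes "settled (tc G n p) p" "p \<le> a"
  shows "kc G n a = kc G n p \<and> hc G n a = hc G n p \<and> (yc n a = yc n p \<longrightarrow> tc G n a = tc G n p) \<or>
    kc G n p < kc G n a \<and>
      hc G n a mod C n ^ Suc (kc G n p) \<noteq> hc G n p + yc n p * C n ^ kc G n p"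
  using assms(2)
proof (induction a rule: less_induct)
  case (less a)
  \<comment> \<open>The condition \<open>i = yc n l\<close> only serves to make \<open>i\<close>
    smaller than \<open>C n\<close>, so that it is a single digit.\<close>
  have ne: "(hc G n p + i * C n ^ kc G n p) mod C n ^ Suc (kc G n p) \<noteq> hc G n p + yc n p * C n ^ kc G n p"
    if "i \<noteq> yc n p" "i = yc n l" for i l
    using next_digit_less[OF hc_less, of n p l] that C_pos[of n] by simp
  have settledD: "x \<in> A \<Longrightarrow> x < tc G n p \<Longrightarrow> p \<le> q \<Longrightarrow> 0 < EA x q" for x q
    using assms(1) EA_mono unfolding settled_iff by blast
  from less.prems show ?case
  proof (cases rule: last_cases[where n = n])
    \<comment> \<open>The recorded state has not moved; only the failure status and the epoch can
      differ at \<open>a\<close>.\<close>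
    case same
    show ?thesis
    proof (cases "fails G n a = fails G n p")
      case True
      then show ?thesis using same unfolding kc_def hc_def h_step_def tc_def t_step_def by auto
    next
      case False
      have "\<not> fails G n p"
      proof
        assume fp: "fails G n p"
        then obtain x where "x < tb G n p" "(0 < EA x p) \<noteq> (0 < EA x (lb G n p - 1))"
          unfolding fails_def seg_eq_iff by blast
        moreover have "lb G n p - 1 \<le> p"
          using state_at_last(1)[of n p "lb G n p - 1"] by (cases "lb G n p") auto
        ultimately have "0 < EA x a" "\<not> 0 < EA x (lb G n p - 1)"
          using EA_mono less.prems by blast+
        with \<open>x < tb G n p\<close> have "fails G n a"
          using same fp unfolding fails_def seg_eq_iff by auto
        with fp False show False by simp
      qed
      with False have fa: "fails G n a" by simp
      then obtain l where l: "lb G n p = Suc l" using same unfolding fails_def by (cases "lb G n p") auto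
      have np: "seg (tb G n p) p = seg (tb G n p) l" using \<open>\<not> fails G n p\<close> l unfolding fails_def by simp
      obtain x where x: "x < tb G n p" "(0 < EA x a) \<noteq> (0 < EA x l)"
        using fa same l unfolding fails_def seg_eq_iff by auto
      have "l \<le> p" using state_at_last(1)[OF l] by simp
      \<comment> \<open>The element causing the failure entered after \<open>l\<close>. It is in
        \<open>A\<close> by stage \<open>p\<close>, which is settled, whereas the absence of a
        failure at \<open>p\<close> excludes this.\<close>
      have "yc n l \<noteq> yc n p"
      proof
        have "x < tc G n p" using x tb_le_tc[of n p] by simp
        have "0 < EA x a" "\<not> 0 < EA x l" using x EA_mono \<open>l \<le> p\<close> less.prems by (meson order_trans)+
        then have "0 < EA x p" using settledD \<open>x < tc G n p\<close> A_iff by blast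
        moreover have "0 < EA x p \<longleftrightarrow> 0 < EA x l" using np x(1) unfolding seg_eq_iff by simp
        ultimately show False using \<open>\<not> 0 < EA x l\<close> by simp
      qed
      moreover have "kc G n p = kb G n p" "hc G n p = hb G n p"
        using \<open>\<not> fails G n p\<close> unfolding kc_def hc_def h_step_def by auto
      moreover have "kc G n a = Suc (kb G n p)" "hc G n a = hb G n p + yc n l * C n ^ kb G n p"
        using fa same l unfolding kc_def hc_def h_step_def by auto
      ultimately show ?thesis using ne[of "yc n l" l] by simp
    qed
  next
    case (later l)
    note last = state_at_last[OF later(1)] kc_hc_at_last[OF later(1)]
    from less.IH[OF last(1) later(2)] show ?thesis
    proof (elim disjE)
      assume *: "kc G n p < kc G n l \<and>
        hc G n l mod C n ^ Suc (kc G n p) \<noteq> hc G n p + yc n p * C n ^ kc G n p"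
      then have "C n ^ Suc (kc G n p) dvd C n ^ kc G n l" by (intro le_imp_power_dvd) simp
      then obtain c where c: "C n ^ kc G n l = C n ^ Suc (kc G n p) * c" ..
      \<comment> \<open>A digit appended later stands in a higher position and leaves the differing
        prefix as it is.\<close>
      have "hc G n a mod C n ^ Suc (kc G n p) = hc G n l mod C n ^ Suc (kc G n p)"
        unfolding last(8) c by (simp add: mult.left_commute[of _ "C n ^ Suc (kc G n p)"] del: power_Suc)
      with * last(7) show ?thesis by simp
    next
      assume *: "kc G n l = kc G n p \<and> hc G n l = hc G n p \<and> (yc n l = yc n p \<longrightarrow> tc G n l = tc G n p)"
      show ?thesis
      proof (cases "fails G n a")
        case False
        have "tc G n a = tc G n p" if "yc n a = yc n p"
        proof -
          have "yc n l = yc n p" using that yc_mono[OF later(2), of n] yc_mono[of l a n] last(1) by simp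
          with * that show ?thesis unfolding tc_def[of G n a] t_step_def using later(1) last(4) by simp
        qed
        with False * last show ?thesis by simp
      next
        case True
        \<comment> \<open>Within the epoch of \<open>p\<close>, the test failing at \<open>a\<close>
          would concern a segment that was already final at \<open>p\<close>.\<close>
        have "yc n l \<noteq> yc n p"
        proof
          assume "yc n l = yc n p"
          then have t: "tb G n a = tc G n p" using * last by simp
          then obtain x where x: "x < tc G n p" "(0 < EA x a) \<noteq> (0 < EA x l)"
            using True later(1) unfolding fails_def seg_eq_iff by auto
          then have "x \<in> A" using A_iff by blast
          with settledD x less.prems later(2) show False by blast
        qed
        from ne[OF this refl] show ?thesis using True * last by simp
      qed
    qed
  qed
qed

text \<open>Both prefixes consist of digits of the same \<open>m\<close>, which excludes the second
  alternative of \<open>state_after_settled\<close>; in the first one the epoch digits must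
  agree.\<close>

lemma same_length_in_box:
  assumes "settled (tc G n p) p" "p \<le> a" "uses_box G n m p" "uses_box G n m a"
  shows "tc G n a = tc G n p"
proof -
  have p: "m mod C n ^ Suc (kc G n p) = hc G n p + yc n p * C n ^ kc G n p"
    using assms(3) unfolding uses_box_def .
  from state_after_settled[OF assms(1,2)] show ?thesis
  proof (elim disjE)
    assume *: "kc G n a = kc G n p \<and> hc G n a = hc G n p \<and> (yc n a = yc n p \<longrightarrow> tc G n a = tc G n p)"
    with p assms(4) C_pos[of n] have "yc n a = yc n p" unfolding uses_box_def by simp
    with * show ?thesis by simp
  next
    assume *: "kc G n p < kc G n a \<and>
      hc G n a mod C n ^ Suc (kc G n p) \<noteq> hc G n p + yc n p * C n ^ kc G n p"
    have "m mod C n ^ kc G n a = hc G n a mod C n ^ kc G n a"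
      using uses_box_mod[OF assms(4)] hc_less[of n a] by simp
    from mod_shorter_prefix[OF this, of "Suc (kc G n p)"] * p show ?thesis by simp
  qed
qed

section \<open>Correct tests are traced, and good stages are infinitely many\<close>

lemma settled_in_trace:
  assumes "n \<le> cc G a" "uses_box G n m a" "settled (tc G n a) a"
  shows "seg (tc G n a) a \<in> T (diag e (pair n m))"
proof -
  define P where "P b \<longleftrightarrow> n \<le> cc G b \<and> uses_box G n m b \<and> settled (tc G n b) b" for b
  define p where "p = (LEAST b. P b)"
  have Pa: "P a" using assms unfolding P_def by simp
  then have Pp: "P p" and pa: "p \<le> a" unfolding p_def by (rule LeastI, rule Least_le)
  have "seg (tc G n p) p \<in> T (diag e (pair n m))"
  proof (rule box_value)
    show "n \<le> cc G p" "uses_box G n m p" "settled (tc G n p) p" using Pp unfolding P_def by auto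
    show "\<not> settled (tc G n b) b" if "b < p" "n \<le> cc G b" "uses_box G n m b" for b
      using not_less_Least[of b P] that unfolding p_def P_def by blast
  qed
  \<comment> \<open>The box program outputs the segment of stage \<open>p\<close>. Both tests are
    correct and equally long, so this is also the segment tested at \<open>a\<close>.\<close>
  moreover have "tc G n a = tc G n p"
    using same_length_in_box[of n p a m] Pp pa assms(2) unfolding P_def by blast
  ultimately show ?thesis using assms(3) Pp unfolding P_def by metis
qed

lemma eventually_yc: "\<exists>a. \<forall>b\<ge>a. yc n b = yc n a"
proof -
  have "finite (range (yc n))" using yc_less[of n] by (meson finite_lessThan finite_subset image_subsetI lessThan_iff)
  then obtain a where "yc n a = Max (range (yc n))" by (metis Max_in UNIV_not_empty image_is_empty imageE)
  then have "yc n b \<le> yc n a" for b using \<open>finite (range (yc n))\<close> by simp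
  then show ?thesis using yc_mono by (metis le_antisym)
qed

lemma eventually_settled: "\<exists>a. \<forall>b\<ge>a. settled t b"
proof -
  have "\<forall>x\<in>{x. x < t \<and> x \<in> A}. \<exists>a. 0 < EA x a" using A_iff by blast
  then obtain s where s: "\<And>x. x < t \<Longrightarrow> x \<in> A \<Longrightarrow> 0 < EA x (s x)" by (metis (mono_tags, lifting) mem_Collect_eq)
  have "settled t b" if "(\<Sum>x<t. s x) \<le> b" for b
    unfolding settled_iff
  proof (intro allI impI)
    fix x assume x: "x < t" "x \<in> A"
    then have "s x \<le> b" using that member_le_sum[of x "{..<t}" s] by simp
    with s[OF x] show "0 < EA x b" by (rule EA_mono)
  qed
  then show ?thesis by blast
qed

text \<open>After a last good stage the state would be frozen with finitely many active levels. Once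
  \<open>Y\<close> and \<open>A\<close> are stable on the relevant segments, the pending tests are
  correct and constant, so the trace confirms them all and another good stage arises.\<close>

lemma infinite_G: "infinite G"
proof
  assume "finite G"
  then obtain a0 where a0: "\<And>q. q \<in> G \<Longrightarrow> q < a0" by (meson bounded_nat_set_is_finite finite_nat_set_iff_bounded)
  have cc: "cc G a = cc G a0" if "a0 \<le> a" for a
    using that by (induction rule: dec_induct) (use a0 in \<open>force simp: cc_Suc\<close>)+
  have st: "lb G n a = lb G n a0" "tb G n a = tb G n a0" "kb G n a = kb G n a0" "hb G n a = hb G n a0"
    if "a0 \<le> a" for n a
    by (rule state_between[OF that]; use a0 in force)+
  have "\<exists>a1. \<forall>a\<ge>a1. \<forall>m<C n ^ (n + 2). uses_box G n m a \<longrightarrow>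
      0 < ET (pair (diag e (pair n m)) (seg (tc G n a) a)) a"
    if n: "n \<le> cc G a0" for n
  proof -
    obtain b1 where b1: "\<forall>b\<ge>b1. yc n b = yc n b1" using eventually_yc by blast
    define a1 where "a1 = max a0 b1"
    have yc: "yc n a = yc n a1" if "a1 \<le> a" for a
      using b1[rule_format, of a] b1[rule_format, of a1] that unfolding a1_def by simp
    \<comment> \<open>Stability below \<open>tb G n a0\<close> fixes the failure status and with it
      the boxes; stability below \<open>tc G n a1\<close> fixes the tested value.\<close>
    obtain b2 where b2: "\<forall>b\<ge>b2. settled (tb G n a0) b" using eventually_settled by blast
    obtain b3 where b3: "\<forall>b\<ge>b3. settled (tc G n a1) b" using eventually_settled by blast
    define a2 where "a2 = max a1 (max b2 b3)"
    have a02: "a0 \<le> a2" unfolding a2_def a1_def by (simp add: le_max_iff_disj)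
    have tc: "tc G n a = tc G n a1" if "a1 \<le> a" for a
      using st[of a n] st[of a1 n] yc[of a] that unfolding tc_def t_step_def a1_def by simp
    have fails: "fails G n a = fails G n a2" if "a2 \<le> a" for a
      using st[of a n] st[of a2 n] b2 that unfolding fails_def a2_def a1_def by simp
    have kh: "kc G n a = kc G n a2" "hc G n a = hc G n a2" if "a2 \<le> a" for a
      using st[of a n] st[of a2 n] fails[of a] that unfolding kc_def hc_def h_step_def a2_def a1_def by simp_all
    have ub: "uses_box G n m a = uses_box G n m a2" if "a2 \<le> a" for a m
      using kh[of a] that yc[of a] yc[of a2] unfolding uses_box_def a2_def by simp
    have sg: "seg (tc G n a) a = seg (tc G n a2) a2" if "a2 \<le> a" for a
      using tc[of a] tc[of a2] b3 that unfolding a2_def by simp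
    have set2: "settled (tc G n a2) a2" using tc[of a2] b3 unfolding a2_def by simp
    have "\<exists>a. 0 < ET (pair (diag e (pair n m)) (seg (tc G n a2) a2)) a" if "uses_box G n m a2" for m
      using settled_in_trace[of n a2 m] that set2 n cc[OF a02] unfolding T_iff by simp
    then obtain s where s: "\<And>m. uses_box G n m a2 \<Longrightarrow>
      0 < ET (pair (diag e (pair n m)) (seg (tc G n a2) a2)) (s m)" by metis
    define a3 where "a3 = a2 + (\<Sum>m<C n ^ (n + 2). s m)"
    have "0 < ET (pair (diag e (pair n m)) (seg (tc G n a) a)) a"
      if "a3 \<le> a" "m < C n ^ (n + 2)" "uses_box G n m a" for a m
    proof -
      have "a2 \<le> a" using that unfolding a3_def by simp
      have "s m \<le> a"
        using that member_le_sum[of m "{..<C n ^ (n + 2)}" s] unfolding a3_def by simp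
      with s[of m] ub[OF \<open>a2 \<le> a\<close>] sg[OF \<open>a2 \<le> a\<close>] that(3) show ?thesis by (metis ET_mono)
    qed
    then show ?thesis by blast
  qed
  then obtain f where f: "\<And>n a m. \<lbrakk>n \<le> cc G a0; f n \<le> a; m < C n ^ (n + 2); uses_box G n m a\<rbrakk> \<Longrightarrow>
      0 < ET (pair (diag e (pair n m)) (seg (tc G n a) a)) a" by metis
  define a where "a = a0 + (\<Sum>n\<le>cc G a0. f n)"
  have "f n \<le> a" if "n \<le> cc G a0" for n
    using member_le_sum[of n "{..cc G a0}" f] that unfolding a_def by simp
  moreover have "cc G a = cc G a0" by (rule cc) (simp add: a_def)
  ultimately have "good G e a" unfolding good_def using f by simp
  then have "a \<in> G" using G_iff by simp
  with a0[of a] show False unfolding a_def by simp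
qed

end

section \<open>Consequences of a late entry into \<open>A\<close>\<close>

context traced_promotion
begin

lemma yc_eq_agree:
  assumes "a \<le> b" "yc n a = yc n b" "z < V n"
  shows "z \<in> set_decode (yd a) \<longleftrightarrow> z \<in> set_decode (yd b)"
  using assms(1,2)
proof (induction b rule: dec_induct)
  case (step b)
  have "yc n a = yc n b" "yc n (Suc b) = yc n b"
    using step yc_mono[of a b n] yc_mono[of b "Suc b" n] by auto
  moreover from this(2) have "(z \<in> set_decode (yd (Suc b))) = (z \<in> set_decode (yd b))"
    using assms(3) unfolding yc_def by auto
  ultimately show ?case using step.IH by simp
qed simp

lemma G_unbounded: "\<exists>a\<in>G. r < a"
  using infinite_G finite_nat_set_iff_bounded_le not_le by metis

lemma cc_unbounded: "\<exists>r. k \<le> cc G r"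
proof (induction k)
  case (Suc k)
  then obtain r where r: "k \<le> cc G r" ..
  obtain a where "a \<in> G" "r < a" using G_unbounded by blast
  then have "Suc k \<le> cc G (Suc a)" using r cc_mono[of r a] by (simp add: cc_Suc)
  then show ?case ..
qed simp

text \<open>\<open>kb\<close> grows after each failure at a good stage, so its value identifies the
  event. This number later becomes a parameter of the diagonal index.\<close>

lemma fails_unique:
  assumes "fails G n a" "a \<in> G" "n \<le> cc G a" "fails G n b" "b \<in> G" "n \<le> cc G b"
    and eq: "kb G n a = kb G n b"
  shows "a = b"
proof -
  have "\<not> c < d" if "fails G n c" "c \<in> G" "n \<le> cc G c" "kb G n c = kb G n d" for c d
  proof
    assume "c < d"
    then have "kb G n (Suc c) \<le> kb G n d" by (intro kb_mono) simp
    with that show False by simp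
  qed
  from this[of a b] this[of b a] show ?thesis using assms by (metis linorder_neqE_nat)
qed

lemma eventually_no_failure:
  assumes "e \<le> n"
  obtains r where "\<And>a. r \<le> a \<Longrightarrow> a \<in> G \<Longrightarrow> n \<le> cc G a \<Longrightarrow> \<not> fails G n a"
proof -
  have "kb G n a \<le> Suc n" for a using kc_le[OF assms, of a] unfolding kc_def by simp
  then have fin: "finite (range (kb G n))" by (meson finite_atMost finite_subset image_subsetI atMost_iff)
  then obtain r where "kb G n r = Max (range (kb G n))"
    by (metis Max_in UNIV_not_empty image_is_empty imageE)
  then have r: "kb G n a \<le> kb G n r" for a using fin by simp
  have "\<not> fails G n a" if "r \<le> a" "a \<in> G" "n \<le> cc G a" for a
    using r[of "Suc a"] kb_mono[OF that(1), of n] that by auto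
  then show thesis by (rule that)
qed

text \<open>Extracts from a wrong answer the level used for diagonalisation: level
  \<open>Suc n\<close> notices the entry of \<open>x\<close>, while level \<open>n\<close> has not
  raised its length above \<open>x\<close>, so \<open>Y\<close> is unchanged below
  \<open>V n\<close> from \<open>r\<close> to \<open>l\<close>. Stage \<open>r0\<close> is past all
  failures of level \<open>N\<close>, which must not be the level that notices.\<close>

lemma late_entry:
  assumes "e \<le> N"
  obtains r0 where "\<And>x r. \<lbrakk>r \<in> G; r0 \<le> r; Suc x + N \<le> cc G r; x \<in> A; EA x r = 0\<rbrakk> \<Longrightarrow>
    \<exists>n a l. N \<le> n \<and> a \<in> G \<and> Suc n \<le> cc G a \<and> lb G (Suc n) a = Suc l \<and> fails G (Suc n) a \<and>
      kb G (Suc n) a \<le> n \<and> V n \<le> x \<and> (\<forall>z<V n. z \<in> set_decode (yd l) \<longleftrightarrow> z \<in> set_decode (yd r))"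
proof -
  obtain r0 where r0: "\<And>a. r0 \<le> a \<Longrightarrow> a \<in> G \<Longrightarrow> N \<le> cc G a \<Longrightarrow> \<not> fails G N a"
    using eventually_no_failure[OF assms] by blast
  have "\<exists>n a l. N \<le> n \<and> a \<in> G \<and> Suc n \<le> cc G a \<and> lb G (Suc n) a = Suc l \<and> fails G (Suc n) a \<and>
      kb G (Suc n) a \<le> n \<and> V n \<le> x \<and> (\<forall>z<V n. z \<in> set_decode (yd l) \<longleftrightarrow> z \<in> set_decode (yd r))"
    if r: "r \<in> G" "r0 \<le> r" "Suc x + N \<le> cc G r" "x \<in> A" "EA x r = 0" for x r
  proof -
    obtain s where s: "0 < EA x s" using r(4) A_iff by blast
    define a where "a = (LEAST b. b \<in> G \<and> 0 < EA x b)"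
    obtain b where "b \<in> G" "s < b" using G_unbounded by blast
    with s have "b \<in> G \<and> 0 < EA x b" using EA_mono by (meson less_imp_le)
    then have a: "a \<in> G" "0 < EA x a" unfolding a_def by (rule LeastI2; blast)+
    have before: "EA x b = 0" if "b \<in> G" "b < a" for b
      using not_less_Least[OF that(2)[unfolded a_def]] that(1) by simp
    have ra: "r < a" using a(2) r(5) EA_mono by (metis less_irrefl not_less)
    have xr: "x < r" using r(3) cc_le[of r] by simp
    \<comment> \<open>The least level from \<open>N\<close> on that covers \<open>x\<close> notices
      the entry. Level \<open>max N (Suc x)\<close> covers \<open>x\<close> because \<open>V\<close>
      dominates the identity, and it is active at \<open>r\<close>.\<close>
    define p where "p = (LEAST p. N \<le> p \<and> x < tb G p a)"
    have ex: "N \<le> max N (Suc x) \<and> x < tb G (max N (Suc x)) a"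
      using V_ge[of "max N (Suc x)"] V_le_tb[of "max N (Suc x)" a] by simp
    have p: "N \<le> p" "x < tb G p a" "p \<le> max N (Suc x)"
      using LeastI[of "\<lambda>p. N \<le> p \<and> x < tb G p a", OF ex]
        Least_le[of "\<lambda>p. N \<le> p \<and> x < tb G p a", OF ex] unfolding p_def by auto
    have pr: "p \<le> cc G r" using p(3) r(3) by auto
    have pa: "p \<le> cc G a" using pr cc_mono[of r a] ra by simp
    obtain l where l: "lb G p a = Suc l" "r \<le> l" using lb_after[OF ra r(1) pr] .
    have lG: "l \<in> G" "l < a" using state_at_last[OF l(1)] by auto
    have f: "fails G p a"
      unfolding fails_def seg_eq_iff using l(1) before[OF lG] a(2) p(2) by auto
    have "p \<noteq> N" using r0[of a] f a(1) pa ra r(2) by auto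
    with p(1) obtain n where n: "p = Suc n" "N \<le> n" by (cases p) auto
    have "\<not> x < tb G n a"
      using not_less_Least[of n "\<lambda>p. N \<le> p \<and> x < tb G p a"] n unfolding p_def by auto
    then have tn: "tb G n a \<le> x" by simp
    then have Vn: "V n \<le> x" using V_le_tb[of n a] by simp
    \<comment> \<open>The present failure itself counts in \<open>kc\<close>, so
      \<open>kc_good\<close> at level \<open>Suc n\<close> leaves at most \<open>n\<close> earlier
      ones.\<close>
    have k: "kb G p a \<le> n"
      using kc_good[of p a] assms p(1) a(1) pa f n(1) unfolding kc_def by simp
    text \<open>A change of \<open>Y\<close> below \<open>V n\<close> after stage \<open>r\<close> would have raised the bound \<open>tb G n a\<close> above \<open>x\<close>.\<close>
    have "yc n q = yc n r" if "q \<in> G" "r \<le> q" "q < a" for q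
      using that
    proof (induction q rule: less_induct)
      case (less q)
      show ?case
      proof (cases "q = r")
        case False
        then have "r < q" using less.prems by simp
        have "n \<le> cc G r" using pr n by simp
        then obtain m where m: "lb G n q = Suc m" "r \<le> m" using lb_after[OF \<open>r < q\<close> r(1)] by blast
        have mq: "m < q" "m \<in> G" using state_at_last[OF m(1)] by auto
        then have "yc n m = yc n r" using less m(2) by simp
        moreover have "yc n q = yc n m"
        proof (rule ccontr)
          assume "yc n q \<noteq> yc n m"
          then have "Suc m \<le> tc G n q" unfolding tc_def t_step_def using m(1) by simp
          moreover have "n \<le> cc G q" using \<open>n \<le> cc G r\<close> cc_mono[of r q] \<open>r < q\<close> by simp
          then have "tb G n (Suc q) = tc G n q" using less.prems(1) by (simp add: tc_def)
          then have "tc G n q \<le> tb G n a" using tb_mono[of "Suc q" a n] less.prems(3) by simp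
          ultimately show False using tn m(2) xr by simp
        qed
        ultimately show ?thesis by simp
      qed simp
    qed
    then have "yc n r = yc n l" using lG l(2) by simp
    then have "\<forall>z<V n. z \<in> set_decode (yd l) \<longleftrightarrow> z \<in> set_decode (yd r)"
      using yc_eq_agree[OF l(2)] by blast
    with n a pa l f k Vn show ?thesis by blast
  qed
  then show thesis by (rule that)
qed

end

subsection \<open>The reduction\<close>

lemma (in computable_promotion) ibT_reducible_of_dnc:
  assumes tp: "traced_promotion EA yd V C ET A T e (goods e)"
    and conv: "\<And>z. \<exists>t. \<forall>s\<ge>t. z \<in> set_decode (yd s) \<longleftrightarrow> z \<in> Y"
    and pf: "\<And>x. \<exists>Q. run Y pf x (f x) Q \<and> (\<forall>q\<in>Q. q \<le> u x)"
    and V_use: "\<And>q n i. q \<le> n \<Longrightarrow> i \<le> n \<Longrightarrow> u (diag q (pair n i)) < V n"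
    and "dnc f"
  shows "ibT_reducible A Y"
proof -
  define G where "G = goods e"
  interpret tp: traced_promotion EA yd V C ET A T e G using tp unfolding G_def .
  \<comment> \<open>The argument \<open>Suc a\<close> makes this finite part decide also whether
    stage \<open>a\<close> itself is good.\<close>
  define Gc where "Gc a = set_decode (good_code e (Suc a))" for a
  have Gc: "q \<in> Gc a \<longleftrightarrow> q \<in> G" if "q < Suc a" for q a
    using that unfolding Gc_def set_decode_good_code G_def by simp
  note st = local_state[of a "Gc a" G for a, OF Gc[OF less_SucI]]
  have Gcc: "a \<in> Gc a \<longleftrightarrow> a \<in> G" for a using Gc by simp
  \<comment> \<open>The search made by \<open>D\<close>: \<open>z\<close> holds an index
    \<open>g\<close>, a level \<open>n\<close> and a failure number \<open>k\<close>;
    \<open>w\<close> holds the stage of that failure of level \<open>Suc n\<close> and a step bound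
    for computing \<open>f\<close> at \<open>g\<close> from the \<open>Y\<close> of the last good
    stage before it.\<close>
  define P where "P z w \<longleftrightarrow> pfst w \<in> Gc (pfst w) \<and> Suc (pfst (psnd z)) \<le> cc (Gc (pfst w)) (pfst w) \<and>
    fails (Gc (pfst w)) (Suc (pfst (psnd z))) (pfst w) \<and>
    kb (Gc (pfst w)) (Suc (pfst (psnd z))) (pfst w) = psnd (psnd z) \<and>
    0 < ev pf (yd (lb (Gc (pfst w)) (Suc (pfst (psnd z))) (pfst w) - 1)) (pfst z) (psnd w)" for z w
  have P: "P (pair g (pair n k)) (pair a s) \<longleftrightarrow> a \<in> G \<and> Suc n \<le> cc G a \<and> fails G (Suc n) a \<and>
    kb G (Suc n) a = k \<and> 0 < ev pf (yd (lb G (Suc n) a - 1)) g s" for g n k a s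
    unfolding P_def by (simp add: st Gcc)
  define S where "S z w = ev pf (yd (lb (Gc (pfst w)) (Suc (pfst (psnd z))) (pfst w) - 1)) (pfst z) (psnd w) - 1"
    for z w
  have S: "S (pair g (pair n k)) (pair a s) = ev pf (yd (lb G (Suc n) a - 1)) g s - 1" for g n k a s
    unfolding S_def by (simp add: st)
  have "dec (\<lambda>z. P (pfst z) (psnd z))"
    unfolding P_def Gc_def by (intro cmp_intros cmp_construction)
  moreover have "cmp (\<lambda>z. S (pfst z) (psnd z))"
    unfolding S_def Gc_def by (intro cmp_intros cmp_construction)
  ultimately obtain D where D: "\<And>A z w. P z w \<Longrightarrow> run A D z (S z (LEAST w. P z w)) {}"
    using partial_search[of P S] by blast
  have diagonal: False
    if n: "code D \<le> n" and a: "a \<in> G" "Suc n \<le> cc G a" "fails G (Suc n) a" "kb G (Suc n) a \<le> n"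
      and l: "lb G (Suc n) a = Suc l" and agree: "\<And>z. z < V n \<Longrightarrow> z \<in> set_decode (yd l) \<longleftrightarrow> z \<in> Y"
    for n a l
  proof -
    define k where "k = kb G (Suc n) a"
    define g where "g = diag (code D) (pair n k)"
    obtain Q where Q: "run Y pf g (f g) Q" "\<forall>q\<in>Q. q \<le> u g" using pf by blast
    \<comment> \<open>The bounds on the code of \<open>D\<close> and on the failure number enter
      here: \<open>V n\<close> dominates the use at indices with both at most
      \<open>n\<close>.\<close>
    have "u g < V n" unfolding g_def by (rule V_use) (use n a(4) in \<open>auto simp: k_def\<close>)
    then have run: "run (set_decode (yd l)) pf g (f g) Q"
      using run_use[OF Q(1), of "set_decode (yd l)"] Q(2) agree by force
    then obtain s where s: "ev pf (yd l) g s = Suc (f g)" using ev_complete by blast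
    let ?z = "pair g (pair n k)"
    have "P ?z (pair a s)" unfolding P using a l s k_def by simp
    note D = D[OF this]
    define w where "w = (LEAST w. P ?z w)"
    have "P ?z w" unfolding w_def by (rule LeastI) fact
    then have w: "P ?z (pair (pfst w) (psnd w))" by simp
    then have "pfst w = a"
      unfolding P k_def using tp.fails_unique a by blast
    with w l have pos: "0 < ev pf (yd l) g (psnd w)" unfolding P by simp
    then obtain y where y: "ev pf (yd l) g (psnd w) = Suc y" using gr0_implies_Suc by blast
    then have "y = f g" using ev_sound run run_deterministic by blast
    moreover have "S ?z w = S ?z (pair (pfst w) (psnd w))" by simp
    then have "S ?z w = ev pf (yd l) g (psnd w) - 1"
      unfolding S using \<open>pfst w = a\<close> l by simp
    ultimately have "S ?z w = f g" using y by simp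
    with D have "run {} D ?z (f g) {}" unfolding w_def[symmetric] by simp
    then have "phi {} g g (f g)" unfolding g_def by (rule phi_diag)
    with \<open>dnc f\<close> show False unfolding dnc_def by blast
  qed
  define N where "N = max e (code D)"
  have N: "e \<le> N" "code D \<le> N" unfolding N_def by auto
  from tp.late_entry[OF N(1)] obtain r0 where r0:
    "\<And>x r. \<lbrakk>r \<in> G; r0 \<le> r; Suc x + N \<le> cc G r; x \<in> A; EA x r = 0\<rbrakk> \<Longrightarrow>
    \<exists>n a l. N \<le> n \<and> a \<in> G \<and> Suc n \<le> cc G a \<and> lb G (Suc n) a = Suc l \<and> fails G (Suc n) a \<and>
      kb G (Suc n) a \<le> n \<and> V n \<le> x \<and> (\<forall>z<V n. z \<in> set_decode (yd l) \<longleftrightarrow> z \<in> set_decode (yd r))"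
    by blast
  \<comment> \<open>\<open>r0\<close> and \<open>N\<close> are constants built into the reduction.
    The lower bound on \<open>cc\<close> makes the required levels active and forces
    \<open>x\<close> below \<open>r\<close>.\<close>
  define B where "B z r \<longleftrightarrow> r \<in> Gc r \<and> r0 \<le> r \<and> Suc (pfst z) + N \<le> cc (Gc r) r \<and>
    (\<forall>y<Suc (pfst z). (y \<in> set_decode (yd r)) = (y \<in> set_decode (psnd z)))" for z r
  have "dec (\<lambda>z. B (pfst z) (psnd z))"
    unfolding B_def Gc_def by (intro cmp_intros cmp_construction)
  moreover have "cmp (\<lambda>z. of_bool (0 < EA (pfst (pfst z)) (psnd z)))"
    by (intro cmp_intros cmp_construction)
  ultimately obtain R where R: "\<And>A z r. B z r \<Longrightarrow> run A R z (of_bool (0 < EA (pfst z) (LEAST r. B z r))) {}"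
    using partial_search[of B "\<lambda>z r. of_bool (0 < EA (pfst z) r)"] by blast
  obtain i where i: "\<And>Y t. \<exists>Q. run Y i t (set_encode {x. x < t \<and> x \<in> Y}) Q \<and> Q \<subseteq> {..<t}"
    using initial_segment_program by blast
  \<comment> \<open>Only the initial segment program asks queries, all below \<open>Suc x\<close>;
    the search for the good stage runs on the segment already read.\<close>
  have "\<exists>Q. run Y (Compose R (Pairing Ident (Compose i Succ))) x (of_bool (x \<in> A)) Q \<and> (\<forall>q\<in>Q. q \<le> x)" for x
  proof -
    let ?z = "pair x (set_encode {y. y < Suc x \<and> y \<in> Y})"
    have B: "B ?z r \<longleftrightarrow> r \<in> G \<and> r0 \<le> r \<and> Suc x + N \<le> cc G r \<and>
        (\<forall>y<Suc x. (y \<in> set_decode (yd r)) = (y \<in> Y))" for r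
      unfolding B_def by (simp add: st Gcc)
    obtain t where t: "\<And>z s. t z \<le> s \<Longrightarrow> z \<in> set_decode (yd s) \<longleftrightarrow> z \<in> Y" using conv by metis
    obtain r1 where r1: "Suc x + N \<le> cc G r1" using tp.cc_unbounded by blast
    obtain r where r: "r \<in> G" "r0 + r1 + (\<Sum>y<Suc x. t y) < r"
      using tp.G_unbounded by blast
    have "t y \<le> r" if "y < Suc x" for y
      using member_le_sum[of y "{..<Suc x}" t] that r(2) by simp
    then have ex: "B ?z r" unfolding B using r r1 tp.cc_mono[of r1 r] t by auto
    define r' where "r' = (LEAST r. B ?z r)"
    have r': "B ?z r'" unfolding r'_def using ex by (rule LeastI)
    have "0 < EA x r' \<longleftrightarrow> x \<in> A"
    proof (rule ccontr)
      assume "\<not> ?thesis"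
      then have *: "EA x r' = 0" "x \<in> A" using tp.A_iff by auto
      from r' have r'': "r' \<in> G" "r0 \<le> r'" "Suc x + N \<le> cc G r'" unfolding B by auto
      from r0[OF r'' *(2,1)] obtain n a l where n: "N \<le> n" "V n \<le> x" and
        a: "a \<in> G" "Suc n \<le> cc G a" "fails G (Suc n) a" "kb G (Suc n) a \<le> n" "lb G (Suc n) a = Suc l"
        and agree: "\<forall>z<V n. z \<in> set_decode (yd l) \<longleftrightarrow> z \<in> set_decode (yd r')" by blast
      have "z \<in> set_decode (yd l) \<longleftrightarrow> z \<in> Y" if "z < V n" for z
        using agree that n(2) r' unfolding B by simp
      from diagonal[OF _ a this] n(1) N(2) show False by simp
    qed
    with R[OF ex, of Y] have run_R: "run Y R ?z (of_bool (x \<in> A)) {}" unfolding r'_def by simp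
    obtain Q where Q: "run Y i (Suc x) (set_encode {y. y < Suc x \<and> y \<in> Y}) Q" "Q \<subseteq> {..<Suc x}"
      using i by blast
    from run.Compose[OF run_Pairing[OF run.Ident run_Compose[OF run.Succ Q(1)]] run_R] Q(2)
    show ?thesis by (intro exI[of _ Q]) auto
  qed
  then show ?thesis unfolding ibT_reducible_def reducible_with_use_def by blast
qed

section \<open>Choice of the parameters\<close>

lemma (in promotion) yc_le_sum:
  assumes "\<And>z. finite {s. s > 0 \<and> (z \<in> set_decode (yd s)) \<noteq> (z \<in> set_decode (yd (s - 1)))}"
    and "\<And>z. card {s. s > 0 \<and> (z \<in> set_decode (yd s)) \<noteq> (z \<in> set_decode (yd (s - 1)))} \<le> b z"
  shows "yc n a \<le> (\<Sum>z<V n. b z)"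
proof -
  let ?c = "\<lambda>z q. (z \<in> set_decode (yd (Suc q))) \<noteq> (z \<in> set_decode (yd q))"
  have "yc n a \<le> (\<Sum>q<a. \<Sum>z<V n. of_bool (?c z q))"
    unfolding yc_def
  proof (rule sum_mono)
    fix q
    show "of_bool (\<not> (\<forall>z<V n. (z \<in> set_decode (yd (Suc q))) = (z \<in> set_decode (yd q))))
        \<le> (\<Sum>z<V n. of_bool (?c z q) :: nat)"
    proof (cases "\<forall>z<V n. \<not> ?c z q")
      case False
      then obtain z where "z < V n" "?c z q" by blast
      then show ?thesis using member_le_sum[of z "{..<V n}" "\<lambda>z. of_bool (?c z q) :: nat"] by auto
    qed simp
  qed
  also have "\<dots> = (\<Sum>z<V n. \<Sum>q<a. of_bool (?c z q))" by (rule sum.swap)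
  also have "\<dots> \<le> (\<Sum>z<V n. b z)"
  proof (rule sum_mono)
    fix z
    have "(\<Sum>q<a. of_bool (?c z q)) = card {q. q < a \<and> ?c z q}"
      by (simp add: Int_def)
    also have "\<dots> \<le> card {s. s > 0 \<and> (z \<in> set_decode (yd s)) \<noteq> (z \<in> set_decode (yd (s - 1)))}"
      by (rule card_inj_on_le[of Suc]) (use assms(1) in auto)
    also have "\<dots> \<le> b z" by (rule assms(2))
    finally show "(\<Sum>q<a. of_bool (?c z q)) \<le> b z" .
  qed
  finally show ?thesis .
qed

text \<open>Provides a slowly growing bound for the trace: \<open>M n\<close> will exceed the
  indices of the boxes of level \<open>n\<close>, which thus get at most \<open>n + 1\<close>
  values.\<close>

lemma order_function_inverse:
  fixes M :: "nat \<Rightarrow> nat"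
  assumes "cmp M" "strict_mono M"
  defines "h \<equiv> \<lambda>j. Suc (LEAST n. j < M n)"
  shows "order_function h" "j < M n \<Longrightarrow> h j \<le> Suc n"
proof -
  have ex: "j < M (Suc j)" for j
    using strict_mono_imp_increasing[OF assms(2), of "Suc j"] by simp
  have less: "j < M (LEAST n. j < M n)" for j using ex by (rule LeastI)
  show le: "h j \<le> Suc n" if "j < M n" for j n
    using that unfolding h_def by (simp add: Least_le)
  have "cmp h" unfolding h_def
    by (intro cmp_intros cmp_comp[OF assms(1)]) (use ex in blast)
  moreover have "h i \<le> h j" if "i \<le> j" for i j
    using le[of i "LEAST n. j < M n"] less[of j] that unfolding h_def by simp
  moreover have "n \<le> h (M n)" for n
    using less[of "M n"] strict_mono_less[OF assms(2)] unfolding h_def by (simp add: less_imp_le le_SucI)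
  ultimately show "order_function h"
    unfolding order_function_def computable_iff_cmp by (auto simp: mono_def h_def)
qed

theorem theorem5p5:
  fixes Y A :: "nat set"
  assumes "omega_ce Y"
    and "\<exists>f. dnc f \<and> wtt_reducible f Y"
    and "ce A"
    and "strongly_jump_traceable A"
  shows "ibT_reducible A Y"
proof -
  obtain Ys b where Ys: "computable_approx Ys Y" and b: "cmp b"
    and fin: "\<And>x. finite {s. s > 0 \<and> (x \<in> Ys s) \<noteq> (x \<in> Ys (s - 1))}"
    and card: "\<And>x. card {s. s > 0 \<and> (x \<in> Ys s) \<noteq> (x \<in> Ys (s - 1))} \<le> b x"
    using assms(1) unfolding omega_ce_def computable_iff_cmp by blast
  define yd where "yd s = set_encode (Ys s)" for s
  have yd: "cmp yd" and dec_yd: "set_decode (yd s) = Ys s" for s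
    using Ys unfolding computable_approx_def computable_iff_cmp yd_def by auto
  have conv: "\<exists>t. \<forall>s\<ge>t. z \<in> set_decode (yd s) \<longleftrightarrow> z \<in> Y" for z
    using Ys unfolding computable_approx_def dec_yd by blast
  obtain f u pf where "dnc f" and u: "cmp u"
    and pf: "\<And>x. \<exists>Q. run Y pf x (f x) Q \<and> (\<forall>q\<in>Q. q \<le> u x)"
    using assms(2) unfolding wtt_reducible_def reducible_with_use_def computable_iff_cmp by blast
  obtain EA where EA: "cmp (\<lambda>z. EA (pfst z) (psnd z))" "\<And>x. x \<in> A \<longleftrightarrow> (\<exists>s. 0 < EA x s)"
    "\<And>x s s'. 0 < EA x s \<Longrightarrow> s \<le> s' \<Longrightarrow> 0 < EA x s'"
    using ce_enumeration[OF assms(3)] by blast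
  \<comment> \<open>The sum dominates the use at all indices that may be needed at level
    \<open>n\<close>, with \<open>q\<close> for the code of the diagonalising program and
    \<open>i\<close> for the failure number; neither program nor number is known yet.\<close>
  define V where "V n = n + (\<Sum>q<Suc n. \<Sum>i<Suc n. Suc (u (diag q (pair n i))))" for n
  have V: "cmp V" unfolding V_def by (intro cmp_intros cmp_comp[OF u])
  have V_use: "u (diag q (pair n i)) < V n" if "q \<le> n" "i \<le> n" for q n i
  proof -
    have "Suc (u (diag q (pair n i))) \<le> (\<Sum>i<Suc n. Suc (u (diag q (pair n i))))"
      using that member_le_sum[of i "{..<Suc n}" "\<lambda>i. Suc (u (diag q (pair n i)))"] by simp
    also have "\<dots> \<le> (\<Sum>q<Suc n. \<Sum>i<Suc n. Suc (u (diag q (pair n i))))"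
      using that member_le_sum[of q "{..<Suc n}" "\<lambda>q. \<Sum>i<Suc n. Suc (u (diag q (pair n i)))"] by simp
    finally show ?thesis unfolding V_def by simp
  qed
  \<comment> \<open>The sum bounds the changes of \<open>Y\<close> below \<open>V n\<close>; epochs
    start at 0, so one more value is possible.\<close>
  define C where "C n = Suc (\<Sum>z<V n. b z)" for n
  have C: "cmp C" unfolding C_def by (intro cmp_intros cmp_comp[OF b] cmp_comp[OF V])
  text \<open>The size bounds on the trace are fixed before the program that uses the boxes is known, so
    that boxes of level \<open>n\<close> are reserved for all programs with code at most \<open>n\<close>.\<close>
  define K where "K n = (\<Sum>e<Suc n. \<Sum>m<C n ^ (n + 2). Suc (diag e (pair n m)))" for n
  have K: "diag e (pair n m) < K n" if "e \<le> n" "m < C n ^ (n + 2)" for e n m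
  proof -
    have "Suc (diag e (pair n m)) \<le> (\<Sum>m<C n ^ (n + 2). Suc (diag e (pair n m)))"
      using that member_le_sum[of m "{..<C n ^ (n + 2)}" "\<lambda>m. Suc (diag e (pair n m))"] by simp
    also have "\<dots> \<le> K n"
      using that member_le_sum[of e "{..<Suc n}" "\<lambda>e. \<Sum>m<C n ^ (n + 2). Suc (diag e (pair n m))"]
      unfolding K_def by simp
    finally show ?thesis by simp
  qed
  define M where "M n = (\<Sum>i<Suc n. Suc (K i))" for n
  have "cmp M" unfolding M_def K_def by (intro cmp_intros cmp_comp[OF C])
  moreover have "strict_mono M" unfolding M_def by (simp add: strict_mono_Suc_iff)
  ultimately obtain h where h: "order_function h" "\<And>j n. j < M n \<Longrightarrow> h j \<le> Suc n"
    using order_function_inverse by blast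
  have KM: "K n < M n" for n unfolding M_def by simp
  obtain T where T: "uniformly_ce T" "\<And>x. finite (T x)" "\<And>x. card (T x) \<le> h x"
    "\<And>x y. jump_fun A x y \<Longrightarrow> y \<in> T x"
    using assms(4) h(1) unfolding strongly_jump_traceable_def by blast
  obtain ET where ET: "cmp (\<lambda>z. ET (pfst z) (psnd z))"
    "\<And>w. w \<in> {pair x y | x y. y \<in> T x} \<longleftrightarrow> (\<exists>s. 0 < ET w s)"
    "\<And>w s s'. 0 < ET w s \<Longrightarrow> s \<le> s' \<Longrightarrow> 0 < ET w s'"
    using ce_enumeration[OF T(1)[unfolded uniformly_ce_def]] by blast
  interpret computable_promotion EA yd V C ET
    by unfold_locales (fact EA(1) yd V C ET(1))+
  \<comment> \<open>The box program simulates a construction that depends on its own code. It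
    recovers this code from its index, the first component of its input.\<close>
  define E where "E z = pfst ((pfst z - 7) div 4)" for z
  define Gd where "Gd z a = set_decode (good_code (E z) a)" for z a
  define R where "R z a \<longleftrightarrow> pfst (psnd z) \<le> cc (Gd z a) a \<and>
    uses_box (Gd z a) (pfst (psnd z)) (psnd (psnd z)) a" for z a
  define t where "t z a = tc (Gd z a) (pfst (psnd z)) a" for z a
  have R: "dec (\<lambda>z. R (pfst z) (psnd z))" unfolding R_def Gd_def E_def
    by (intro cmp_intros cmp_construction)
  have t: "cmp (\<lambda>z. t (pfst z) (psnd z))" unfolding t_def Gd_def E_def
    by (intro cmp_intros cmp_construction)
  have S: "cmp (\<lambda>z. seg (t (pfst z) (psnd z)) (psnd z))"
    by (intro cmp_intros cmp_construction t)
  obtain P where P: "\<And>A z a. \<lbrakk>R z a; seg (t z a) a = set_encode {y. y < t z a \<and> y \<in> A};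
      \<And>m. \<lbrakk>m < a; R z m\<rbrakk> \<Longrightarrow> seg (t z m) m \<noteq> set_encode {y. y < t z m \<and> y \<in> A}\<rbrakk>
      \<Longrightarrow> \<exists>Q. run A P z (seg (t z a) a) Q"
    using oracle_search[OF R t S] by blast
  define e where "e = code P"
  have "traced_promotion EA yd V C ET A T e (goods e)"
  proof
    show "x \<in> A \<longleftrightarrow> (\<exists>a. 0 < EA x a)" for x by (rule EA(2))
    show "0 < EA x a \<Longrightarrow> a \<le> b \<Longrightarrow> 0 < EA x b" for x a b by (rule EA(3))
    show "y \<in> T j \<longleftrightarrow> (\<exists>a. 0 < ET (pair j y) a)" for y j using ET(2)[of "pair j y"] by auto
    show "0 < ET w a \<Longrightarrow> a \<le> b \<Longrightarrow> 0 < ET w b" for w a b by (rule ET(3))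
    show "yc n a < C n" for n a
      using yc_le_sum[of b n a] fin card unfolding C_def dec_yd by (simp add: less_Suc_eq_le)
    show "n \<le> V n" for n unfolding V_def by simp
    show "finite (T j)" for j by (rule T(2))
    show "card (T (diag e (pair n m))) \<le> Suc n" if "e \<le> n" "m < C n ^ (n + 2)" for n m
      using T(3)[of "diag e (pair n m)"] h(2)[of "diag e (pair n m)" n] K[OF that] KM[of n] by simp
    show "a \<in> goods e \<longleftrightarrow> good (goods e) e a" for a by (rule goods_iff)
    fix n m a
    let ?G = "goods e" and ?z = "pair (diag e (pair n m)) (pair n m)"
    have "q \<in> Gd ?z a \<longleftrightarrow> q \<in> ?G" if "q < a" for q a
      using that unfolding Gd_def E_def by (simp add: set_decode_good_code diag_program)
    note st = local_state[of a "Gd ?z a" ?G for a, OF this] uses_box_local[of a "Gd ?z a" ?G for a, OF this]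
    have R: "R ?z a \<longleftrightarrow> n \<le> cc ?G a \<and> uses_box ?G n m a" for a
      unfolding R_def by (simp add: st)
    have t: "t ?z a = tc ?G n a" for a unfolding t_def by (simp add: st)
    assume "n \<le> cc ?G a" "uses_box ?G n m a"
      "seg (tc ?G n a) a = set_encode {x. x < tc ?G n a \<and> x \<in> A}"
      "\<And>b. \<lbrakk>b < a; n \<le> cc ?G b; uses_box ?G n m b\<rbrakk> \<Longrightarrow>
        seg (tc ?G n b) b \<noteq> set_encode {x. x < tc ?G n b \<and> x \<in> A}"
    then have "\<exists>Q. run A P ?z (seg (t ?z a) a) Q" by (intro P) (auto simp: R t)
    then have "\<exists>Q. run A P ?z (seg (tc ?G n a) a) Q" by (simp only: t)
    then have "jump_fun A (diag e (pair n m)) (seg (tc ?G n a) a)"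
      unfolding e_def jump_fun_def by (elim exE) (rule phi_diag)
    then show "seg (tc ?G n a) a \<in> T (diag e (pair n m))" by (rule T(4))
  qed
  from ibT_reducible_of_dnc[OF this conv pf V_use \<open>dnc f\<close>] show ?thesis .
qed

end
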